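(* Let $(\mathbb{X},\rho)$ be a Hadamard space and $\mu$ a Borel probability measure on $\mathbb{X}$ with $\|\rho\|_{\psi_1}<+\infty$. Let $X_1,\dots,X_n$ be independent random variables of law $\mu$, let $\phi_*$ be the (unique) minimizer over $\phi\in\mathbb{X}$ of $\int_{\mathbb{X}}\rho(\phi,x)^2\,d\mu(x)$ and $\widehat\phi$ the (unique) minimizer over $\phi\in\mathbb{X}$ of $\frac1n\sum_{i=1}^n\rho(\phi,X_i)^2$. Then, for any $\delta>0$, $$\rho(\phi_*,\widehat\phi)\le16\|\rho\|_{\psi_1}\left(n^{-\frac12}+2\sqrt{\frac1n\log\left(\frac1\delta\right)}+\frac1n\log\left(\frac1\delta\right)\right)$$ with probability at least $1-\delta$, and $$\mathbb{E}\left[\rho(\phi_*,\widehat\phi)^2\right]\le2^8\|\rho\|_{\psi_1}^2n^{-1}.$$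
   Context: A Hadamard space is a complete geodesic metric space $(\mathbb{X},\rho)$ such that $\rho(\phi,x)^2-\rho(\psi,x)^2-\rho(\phi,y)^2+\rho(\psi,y)^2\le2\rho(x,y)\rho(\phi,\psi)$ for all $x,y,\phi,\psi\in\mathbb{X}$. Geodesic means that any two points are joined by a path whose length equals their distance. For a real random variable $Z$, $\|Z\|_{\psi_1}=\inf\{c>0:\mathbb{E}\exp(|Z|/c)\le2\}$, and $\|\rho\|_{\psi_1}$ denotes $\|\rho(X,Y)\|_{\psi_1}$ for independent $X,Y\sim\mu$. Under these hypotheses both minimizers exist and are unique. For $\delta\ge1$ the probability statement is vacuous.
   Formalization: The measure μ is assumed to have separable support (a closed separable set of full measure); without this ρ(X,Y) need not be measurable and ‖ρ‖_{ψ1} may be undefined. This is automatic on separable spaces, and on all metric spaces if no real-valued measurable cardinal exists. *)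

theory Defs
  imports "HOL-Probability.Probability"
begin

definition curve_length :: "(real \<Rightarrow> 'a::metric_space) \<Rightarrow> ennreal" where
  "curve_length g =
     (SUP (N, t) \<in> {(N :: nat, t :: nat \<Rightarrow> real).
                      (\<forall>i\<le>N. t i \<in> {0..1}) \<and> (\<forall>i<N. t i \<le> t (Suc i))}.
        \<Sum>i<N. ennreal (dist (g (t i)) (g (t (Suc i)))))"

class hadamard_space = complete_space +
  assumes geodesic:
    "\<exists>g. path g \<and> pathstart g = x \<and> pathfinish g = y \<and> curve_length g = ennreal (dist x y)"
  and quadruple:
    "(dist p x)\<^sup>2 - (dist q x)\<^sup>2 - (dist p y)\<^sup>2 + (dist q y)\<^sup>2 \<le> 2 * dist x y * dist p q"

text \<open>The infimum is taken in the extended non-negative reals, so that it is infinite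
  if no \<open>c\<close> is admissible.\<close>

definition psi1_norm :: "'w measure \<Rightarrow> ('w \<Rightarrow> real) \<Rightarrow> ennreal" where
  "psi1_norm M Z =
     Inf {ennreal c | c. 0 < c \<and> (\<integral>\<^sup>+ w. ennreal (exp (\<bar>Z w\<bar> / c)) \<partial>M) \<le> 2}"

text \<open>Two independent points of law \<open>mu\<close> are realised as the coordinates on the
  product space.\<close>

definition dist_psi1_norm :: "'a::metric_space measure \<Rightarrow> ennreal" where
  "dist_psi1_norm mu = psi1_norm (mu \<Otimes>\<^sub>M mu) (\<lambda>(x, y). dist x y)"

text \<open>Almost every point lies in one closed separable set. This is automatic if the space is
  separable. Without it the distance of two independent points of law \<open>mu\<close> need not be
  measurable, not even for the completed product measure; with it this distance, and every
  continuous real function of finitely many such points, is measurable for the completion.\<close>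

definition separably_supported :: "'a::metric_space measure \<Rightarrow> bool" where
  "separably_supported mu \<longleftrightarrow> (\<exists>D. countable D \<and> (AE x in mu. x \<in> closure D))"

definition is_barycenter :: "'a::metric_space measure \<Rightarrow> 'a \<Rightarrow> bool" where
  "is_barycenter mu p \<longleftrightarrow>
     is_arg_min (\<lambda>q. \<integral>\<^sup>+ x. ennreal ((dist q x)\<^sup>2) \<partial>mu) (\<lambda>_. True) p"

definition is_empirical_barycenter :: "nat \<Rightarrow> (nat \<Rightarrow> 'a::metric_space) \<Rightarrow> 'a \<Rightarrow> bool" where
  "is_empirical_barycenter n xs p \<longleftrightarrow>
     is_arg_min (\<lambda>q. 1 / real n * (\<Sum>i = 1..n. (dist q (xs i))\<^sup>2)) (\<lambda>_. True) p"

end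

theory Submission
  imports Defs
begin

text \<open>The quadruple inequality in a geodesic space yields the CAT(0) inequality, so squared
  distances are strongly convex along geodesics and both barycenters satisfy a variance inequality
  with constant one. Combined with the quadruple inequality, this makes the empirical barycenter
  a \<open>1/n\<close>-Lipschitz function of the sample in the \<open>l\<^sup>1\<close> distance.

  Replacing one sample point by an independent copy hence moves the empirical barycenter by little,
  and this stability bounds the second moment of the distance to the barycenter. The deviation from
  the mean is controlled by a bounded-difference argument in which each oscillation has an
  exponential moment: conditionally on the other points, symmetrization reduces the centered
  exponential moment to that of \<open>cosh\<close> of the distance of two independent points.

  As the space may be non-separable, Lipschitz functions of the sample are replaced by measurable
  versions that agree with them on the closure of a countable set of full measure.\<close>

section \<open>Convexity and barycenters in Hadamard spaces\<close>

text \<open>Two points fix the shape of the estimates. First, symmetrization leads to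
  \<open>cosh\<close>, which has no linear term, so an oscillation scaled by \<open>s\<close> costs
  a factor \<open>exp (s^2 / 2)\<close> per coordinate and not one of order \<open>exp s\<close>;
  over \<open>n\<close> coordinates this yields deviations of order \<open>n powr (-1/2)\<close>.
  Exponential moments are available only for \<open>s <= 1\<close>, and this cap produces the term
  linear in the logarithm. Second, all bounds are proved for an arbitrary admissible
  \<open>c\<close> in place of the norm: the squared distance of two independent points has mean at
  most \<open>2 * c^2\<close>, the two variance inequalities contribute a factor 2 on the other
  side, and the mean squared error is at most \<open>c^2 / n\<close>. The constants 16 and
  \<open>2 ^ 8\<close> thus leave ample room for passing from \<open>c\<close> to the
  infimum.\<close>

definition intermediate :: "real \<Rightarrow> 'a::metric_space \<Rightarrow> 'a \<Rightarrow> 'a \<Rightarrow> bool" where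
  "intermediate t x y z \<longleftrightarrow> dist x z = t * dist x y \<and> dist z y = (1 - t) * dist x y"

text \<open>Later only distances matter, so two equations stand in for a parametrized geodesic. The
  intermediate value theorem finds a curve point at the right distance from \<open>x\<close>; the
  length of the curve then leaves no slack in the triangle inequality through it.\<close>

lemma intermediate_point_exists:
  fixes x y :: "'a::hadamard_space"
  assumes "0 \<le> t" "t \<le> 1"
  obtains z where "intermediate t x y z"
proof -
  obtain g where g: "path g" "pathstart g = x" "pathfinish g = y"
    and len: "curve_length g = ennreal (dist x y)"
    using geodesic by blast
  have ends: "g 0 = x" "g 1 = y"
    using g by (auto simp: pathstart_def pathfinish_def)
  have "continuous_on {0..1} (\<lambda>s. dist x (g s))"
    using g(1) by (intro continuous_intros) (auto simp: path_def)
  then have "\<exists>s\<ge>0. s \<le> 1 \<and> dist x (g s) = t * dist x y"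
    using assms ends by (intro IVT') (auto simp: mult_left_le_one_le)
  then obtain s where s: "0 \<le> s" "s \<le> 1" "dist x (g s) = t * dist x y"
    by blast
  \<comment> \<open>The partition \<open>0, s, 1\<close>, whose polygonal length is at most that of
    the curve.\<close>
  define T :: "nat \<Rightarrow> real" where "T i = (if i = 0 then 0 else if i = 1 then s else 1)" for i
  have "(\<Sum>i<2. ennreal (dist (g (T i)) (g (T (Suc i))))) \<le> curve_length g"
    unfolding curve_length_def
    by (rule SUP_upper2[of "(2, T)"]) (use s in \<open>auto simp: T_def\<close>)
  then have "ennreal (dist x (g s) + dist (g s) y) \<le> ennreal (dist x y)"
    by (simp add: len T_def ends numeral_2_eq_2)
  then have "dist x (g s) + dist (g s) y \<le> dist x y"
    by (subst (asm) ennreal_le_iff) auto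
  then have "dist (g s) y = (1 - t) * dist x y"
    using s(3) dist_triangle[of x y "g s"] by (simp add: algebra_simps)
  then show thesis
    using s(3) that[of "g s"] by (simp add: intermediate_def)
qed

lemma quadrilateral:
  fixes p q x y :: "'a::hadamard_space"
  shows "(dist p x)\<^sup>2 + (dist q y)\<^sup>2 \<le> (dist q x)\<^sup>2 + (dist p y)\<^sup>2 + 2 * dist x y * dist p q"
  using quadruple[of p x q y] by simp

text \<open>The CAT(0) inequality up to an error that is quadratic in \<open>s\<close>. With \<open>Q\<close> at the same
  fraction \<open>s\<close> of the side from \<open>A\<close> to \<open>C\<close>, the quadrilaterals \<open>A, Q, B, P\<close> and
  \<open>P, Q, C, B\<close> bound the distance of \<open>Q\<close> and \<open>B\<close> from below and from above.\<close>

lemma dist_intermediate_weak: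
  fixes A B C P :: "'a::hadamard_space"
  assumes s: "0 < s" "s \<le> 1" and P: "intermediate s A B P"
  shows "(dist P C)\<^sup>2 \<le> (1 - s) * (dist A C)\<^sup>2 + s * (dist B C)\<^sup>2
           - s * (1 - s) * (dist A B)\<^sup>2 + s\<^sup>2 * (dist A C)\<^sup>2"
proof -
  obtain Q where Q: "intermediate s A C Q"
    using intermediate_point_exists s by (metis less_imp_le)
  define a b c t where "a = dist B C" and "b = dist A C" and "c = dist A B" and "t = dist P Q"
  have d: "dist A P = s * c" "dist P B = (1 - s) * c" "dist A Q = s * b" "dist Q C = (1 - s) * b"
    using P Q by (auto simp: intermediate_def b_def c_def)
  have "c\<^sup>2 + t\<^sup>2 \<le> (s * b)\<^sup>2 + ((1 - s) * c)\<^sup>2 + 2 * (s * c) * dist Q B"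
    using quadrilateral[of A B P Q]
    by (simp add: d c_def[symmetric] t_def[symmetric] dist_commute[of B Q] mult.commute mult.left_commute)
  also have "2 * (s * c) * dist Q B \<le> s * (c\<^sup>2 + (dist Q B)\<^sup>2)"
    using mult_left_mono[OF sum_squares_bound[of c "dist Q B"], of s] s by (simp add: algebra_simps)
  finally have lower: "t\<^sup>2 + s * c\<^sup>2 - s\<^sup>2 * (b\<^sup>2 + c\<^sup>2) \<le> s * (dist Q B)\<^sup>2"
    by (simp add: algebra_simps power2_eq_square)
  have "(dist P C)\<^sup>2 + (dist Q B)\<^sup>2 \<le> ((1 - s) * b)\<^sup>2 + ((1 - s) * c)\<^sup>2 + 2 * a * t"
    using quadrilateral[of P C Q B]
    by (simp add: d a_def[symmetric] t_def[symmetric] dist_commute[of C B])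
  then have upper: "s * (dist P C)\<^sup>2 + s * (dist Q B)\<^sup>2 \<le>
      s * (((1 - s) * b)\<^sup>2 + ((1 - s) * c)\<^sup>2) + 2 * (s * a) * t"
    using mult_left_mono[of _ _ s] s by (fastforce simp: algebra_simps)
  \<comment> \<open>The factors are grouped so that \<open>t^2\<close> cancels against
    \<open>lower\<close>; nothing else is known about \<open>t\<close>.\<close>
  have "2 * (s * a) * t \<le> (s * a)\<^sup>2 + t\<^sup>2"
    by (rule sum_squares_bound)
  with lower upper have "s * (dist P C)\<^sup>2 \<le>
      s * ((1 - s) * b\<^sup>2 + s * a\<^sup>2 - s * (1 - s) * c\<^sup>2 + s\<^sup>2 * b\<^sup>2)"
    by (simp add: algebra_simps power2_eq_square)
  then show ?thesis
    using s by (simp add: a_def b_def c_def)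
qed

text \<open>The error term disappears when the weak form is applied to points on the geodesic from
  \<open>z\<close> to \<open>p\<close> that approach \<open>z\<close>.\<close>

lemma dist_intermediate:
  fixes x y z p :: "'a::hadamard_space"
  assumes l: "0 \<le> l" "l \<le> 1" and z: "intermediate l x y z"
  shows "(dist z p)\<^sup>2 \<le> (1 - l) * (dist x p)\<^sup>2 + l * (dist y p)\<^sup>2 - l * (1 - l) * (dist x y)\<^sup>2"
proof -
  define D L where "D = dist x y" and "L = dist z p"
  define E where "E = (1 - l) * (dist x p)\<^sup>2 + l * (dist y p)\<^sup>2 - l * (1 - l) * D\<^sup>2"
  have zd: "dist z x = l * D" "dist z y = (1 - l) * D"
    using z by (auto simp: intermediate_def D_def dist_commute)
  have bound: "(1 - s) * L\<^sup>2 \<le> E + s * (l * (1 - l) * D\<^sup>2)" if s: "0 < s" "s \<le> 1" for s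
  proof -
    obtain q where q: "intermediate s z p q"
      using intermediate_point_exists s by (metis less_imp_le)
    have X: "(dist q x)\<^sup>2 \<le> (1 - s) * (l * D)\<^sup>2 + s * (dist x p)\<^sup>2 - s * (1 - s) * L\<^sup>2 + s\<^sup>2 * (l * D)\<^sup>2"
      using dist_intermediate_weak[OF s q, of x] by (simp add: zd L_def dist_commute[of p])
    have Y: "(dist q y)\<^sup>2 \<le> (1 - s) * ((1 - l) * D)\<^sup>2 + s * (dist y p)\<^sup>2 - s * (1 - s) * L\<^sup>2
        + s\<^sup>2 * ((1 - l) * D)\<^sup>2"
      using dist_intermediate_weak[OF s q, of y] by (simp add: zd L_def dist_commute[of p])
    have "D \<le> dist q x + dist q y"
      unfolding D_def by (rule dist_triangle3)
    then have "D\<^sup>2 \<le> (dist q x + dist q y)\<^sup>2"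
      by (simp add: D_def power_mono)
    \<comment> \<open>At \<open>q = z\<close> this lower bound is an equality. Hence in the
      comparison with \<open>X\<close> and \<open>Y\<close> the terms free of \<open>s\<close>
      cancel and a factor \<open>s\<close> can be divided out.\<close>
    then have "l * (1 - l) * D\<^sup>2 \<le> l * (1 - l) * (dist q x + dist q y)\<^sup>2"
      using l by (intro mult_left_mono) auto
    also have "\<dots> \<le> (1 - l) * (dist q x)\<^sup>2 + l * (dist q y)\<^sup>2"
    proof -
      have "0 \<le> ((1 - l) * dist q x - l * dist q y)\<^sup>2" by simp
      then show ?thesis by (simp add: algebra_simps power2_eq_square)
    qed
    also have "\<dots> \<le> (1 - l) * ((1 - s) * (l * D)\<^sup>2 + s * (dist x p)\<^sup>2 - s * (1 - s) * L\<^sup>2 + s\<^sup>2 * (l * D)\<^sup>2)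
       + l * ((1 - s) * ((1 - l) * D)\<^sup>2 + s * (dist y p)\<^sup>2 - s * (1 - s) * L\<^sup>2 + s\<^sup>2 * ((1 - l) * D)\<^sup>2)"
      using X Y l by (intro add_mono mult_left_mono) auto
    finally have "s * ((1 - s) * L\<^sup>2) \<le> s * (E + s * (l * (1 - l) * D\<^sup>2))"
      by (simp add: E_def algebra_simps power2_eq_square)
    then show ?thesis using s by simp
  qed
  have "L\<^sup>2 \<le> E"
  proof (rule tendsto_le[OF trivial_limit_at_right_real])
    show "((\<lambda>s. E + s * (l * (1 - l) * D\<^sup>2)) \<longlongrightarrow> E) (at_right 0)"
      by (auto intro!: tendsto_eq_intros)
    show "((\<lambda>s. (1 - s) * L\<^sup>2) \<longlongrightarrow> L\<^sup>2) (at_right 0)"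
      by (auto intro!: tendsto_eq_intros)
    show "\<forall>\<^sub>F s in at_right 0. (1 - s) * L\<^sup>2 \<le> E + s * (l * (1 - l) * D\<^sup>2)"
      using eventually_at_right_less eventually_at_right_real[of 0 1]
      by (auto elim!: eventually_mono intro!: bound)
  qed
  then show ?thesis by (simp add: L_def E_def D_def)
qed

section \<open>Strongly convex functions and their minimizers\<close>

definition strongly_convex :: "('a::metric_space \<Rightarrow> real) \<Rightarrow> bool" where
  "strongly_convex F \<longleftrightarrow> (\<forall>l x y z. 0 \<le> l \<longrightarrow> l \<le> 1 \<longrightarrow> intermediate l x y z \<longrightarrow>
     F z \<le> (1 - l) * F x + l * F y - l * (1 - l) * (dist x y)\<^sup>2)"

lemma strongly_convexD:
  "strongly_convex F \<Longrightarrow> 0 \<le> l \<Longrightarrow> l \<le> 1 \<Longrightarrow> intermediate l x y z \<Longrightarrow>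
     F z \<le> (1 - l) * F x + l * F y - l * (1 - l) * (dist x y)\<^sup>2"
  by (auto simp: strongly_convex_def)

text \<open>A move by the fraction \<open>l\<close> from \<open>m\<close> towards \<open>q\<close>
  cannot lower \<open>F\<close>; dividing the convexity inequality by \<open>l\<close> and letting
  \<open>l\<close> tend to 0 leaves the modulus. The modulus is that of the squared distance in a
  Hilbert space, hence the constant one.\<close>

lemma variance_inequality:
  fixes F :: "'a::hadamard_space \<Rightarrow> real"
  assumes F: "strongly_convex F" and min: "\<And>q. F m \<le> F q"
  shows "(dist m q)\<^sup>2 \<le> F q - F m"
proof (rule tendsto_le[OF trivial_limit_at_right_real])
  show "((\<lambda>l. F q - F m) \<longlongrightarrow> F q - F m) (at_right 0)"
    by simp
  show "((\<lambda>l. (1 - l) * (dist m q)\<^sup>2) \<longlongrightarrow> (dist m q)\<^sup>2) (at_right 0)"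
    by (auto intro!: tendsto_eq_intros)
  have "(1 - l) * (dist m q)\<^sup>2 \<le> F q - F m" if l: "0 < l" "l < 1" for l
  proof -
    obtain z where "intermediate l m q z"
      using intermediate_point_exists l by (metis less_imp_le)
    from strongly_convexD[OF F _ _ this] l min[of z]
    have "l * ((1 - l) * (dist m q)\<^sup>2) \<le> l * (F q - F m)"
      by (simp add: algebra_simps)
    then show ?thesis using l by simp
  qed
  then show "\<forall>\<^sub>F l in at_right 0. (1 - l) * (dist m q)\<^sup>2 \<le> F q - F m"
    using eventually_at_right_real[of 0 1] by (auto elim!: eventually_mono)
qed

text \<open>Completeness replaces compactness: the midpoint of two almost-minimizers cannot fall
  below the infimum, so strong convexity forces them to be close and a minimizing sequence is
  Cauchy.\<close>

lemma strongly_convex_attains_min: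
  fixes F :: "'a::hadamard_space \<Rightarrow> real"
  assumes F: "strongly_convex F" and cont: "continuous_on UNIV F" and lower: "\<And>q. b \<le> F q"
  obtains m where "\<And>q. F m \<le> F q"
proof -
  define I where "I = (INF q. F q)"
  have bdd: "bdd_below (range F)"
    using lower by (intro bdd_belowI[of _ b]) auto
  have I_le: "I \<le> F q" for q
    unfolding I_def by (rule cINF_lower[OF bdd]) simp
  have "\<exists>q. F q < I + inverse (real (Suc k))" for k
    using cInf_lessD[of "range F" "I + inverse (real (Suc k))"] by (auto simp: I_def)
  then obtain p where p: "\<And>k. F (p k) < I + inverse (real (Suc k))"
    by metis
  have close: "(dist x y)\<^sup>2 \<le> 2 * (F x - I) + 2 * (F y - I)" for x y
  proof -
    obtain z where "intermediate (1/2) x y z"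
      using intermediate_point_exists[of "1/2" x y] by auto
    from strongly_convexD[OF F _ _ this] I_le[of z] show ?thesis
      by simp
  qed
  have "Cauchy p"
  proof (rule metric_CauchyI)
    fix e :: real assume "0 < e"
    then obtain N where N: "inverse (real (Suc N)) < e\<^sup>2 / 4"
      using reals_Archimedean[of "e\<^sup>2 / 4"] by auto
    have small: "4 * (F (p k) - I) < e\<^sup>2" if "N \<le> k" for k
    proof -
      have "F (p k) - I < inverse (real (Suc k))"
        using p[of k] by simp
      also have "\<dots> \<le> inverse (real (Suc N))"
        using that by (intro le_imp_inverse_le) auto
      also note N
      finally show ?thesis by simp
    qed
    show "\<exists>N. \<forall>k\<ge>N. \<forall>j\<ge>N. dist (p k) (p j) < e"
    proof (intro exI allI impI)
      fix k j assume "N \<le> k" "N \<le> j"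
      then have "2 * (F (p k) - I) + 2 * (F (p j) - I) < e\<^sup>2"
        using small[of k] small[of j] by simp
      then have "(dist (p k) (p j))\<^sup>2 < e\<^sup>2"
        using close[of "p k" "p j"] by (rule le_less_trans[rotated])
      then show "dist (p k) (p j) < e"
        using \<open>0 < e\<close> power2_less_imp_less[of _ e] by simp
    qed
  qed
  then obtain m where m: "p \<longlonglongrightarrow> m"
    using Cauchy_convergent convergent_def by blast
  then have "(\<lambda>k. F (p k)) \<longlonglongrightarrow> F m"
    using cont by (intro isCont_tendsto_compose[of m F]) (auto simp: continuous_on_eq_continuous_at)
  moreover have "(\<lambda>k. I + inverse (real (Suc k))) \<longlonglongrightarrow> I + 0"
    by (intro tendsto_intros LIMSEQ_inverse_real_of_nat)
  ultimately have "F m \<le> I"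
    using p by (intro LIMSEQ_le[of "\<lambda>k. F (p k)" _ "\<lambda>k. I + inverse (real (Suc k))"])
      (auto intro: less_imp_le)
  with I_le show thesis
    by (intro that[of m]) (meson order_trans)
qed

section \<open>Barycenters of samples and of measures\<close>

definition empirical_risk :: "nat \<Rightarrow> (nat \<Rightarrow> 'a::metric_space) \<Rightarrow> 'a \<Rightarrow> real" where
  "empirical_risk n xs q = 1 / real n * (\<Sum>i = 1..n. (dist q (xs i))\<^sup>2)"

lemma is_empirical_barycenter_iff:
  "is_empirical_barycenter n xs m \<longleftrightarrow> (\<forall>q. empirical_risk n xs m \<le> empirical_risk n xs q)"
  by (auto simp: is_empirical_barycenter_def is_arg_min_def empirical_risk_def not_less)

lemma empirical_risk_nonneg: "0 \<le> empirical_risk n xs q"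
  by (simp add: empirical_risk_def sum_nonneg)

lemma strongly_convex_empirical_risk:
  fixes xs :: "nat \<Rightarrow> 'a::hadamard_space"
  assumes "n \<ge> 1"
  shows "strongly_convex (empirical_risk n xs)"
  unfolding strongly_convex_def
proof (intro allI impI)
  fix l :: real and x y z :: 'a
  assume l: "0 \<le> l" "l \<le> 1" and z: "intermediate l x y z"
  have "empirical_risk n xs z \<le> 1 / real n * (\<Sum>i = 1..n. (1 - l) * (dist x (xs i))\<^sup>2
      + l * (dist y (xs i))\<^sup>2 - l * (1 - l) * (dist x y)\<^sup>2)"
    unfolding empirical_risk_def
    by (intro mult_left_mono sum_mono dist_intermediate[OF l z]) auto
  also have "\<dots> = (1 - l) * empirical_risk n xs x + l * empirical_risk n xs y
      - l * (1 - l) * (dist x y)\<^sup>2"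
    using assms
    by (simp add: empirical_risk_def sum.distrib sum_subtractf sum_distrib_left[symmetric]
        divide_simps)
  finally show "empirical_risk n xs z \<le> (1 - l) * empirical_risk n xs x
      + l * empirical_risk n xs y - l * (1 - l) * (dist x y)\<^sup>2" .
qed

lemma empirical_barycenter_exists:
  fixes xs :: "nat \<Rightarrow> 'a::hadamard_space"
  assumes "n \<ge> 1"
  obtains m where "is_empirical_barycenter n xs m"
proof -
  have "continuous_on UNIV (empirical_risk n xs)"
    unfolding empirical_risk_def by (intro continuous_intros)
  then obtain m where "\<And>q. empirical_risk n xs m \<le> empirical_risk n xs q"
    using strongly_convex_attains_min[OF strongly_convex_empirical_risk[OF assms, of xs]]
      empirical_risk_nonneg by blast
  then show thesis
    using that is_empirical_barycenter_iff by blast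
qed

lemma empirical_variance_inequality:
  fixes xs :: "nat \<Rightarrow> 'a::hadamard_space"
  assumes "n \<ge> 1" "is_empirical_barycenter n xs m"
  shows "(dist m q)\<^sup>2 \<le> empirical_risk n xs q - empirical_risk n xs m"
  using assms by (intro variance_inequality strongly_convex_empirical_risk)
    (auto simp: is_empirical_barycenter_iff)

text \<open>Each variance inequality is evaluated at the minimizer of the other sample. Their sum
  regroups into one quadruple expression per index, linear in \<open>dist m m'\<close>, while the
  left side is quadratic in it; the factors 2 cancel.\<close>

lemma empirical_barycenter_lipschitz:
  fixes xs ys :: "nat \<Rightarrow> 'a::hadamard_space"
  assumes n: "n \<ge> 1" and m: "is_empirical_barycenter n xs m" and m': "is_empirical_barycenter n ys m'"
  shows "dist m m' \<le> 1 / real n * (\<Sum>i = 1..n. dist (xs i) (ys i))"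
proof -
  define S where "S = 1 / real n * (\<Sum>i = 1..n. dist (xs i) (ys i))"
  have "2 * (dist m m')\<^sup>2 \<le> empirical_risk n xs m' - empirical_risk n xs m
      + (empirical_risk n ys m - empirical_risk n ys m')"
    using empirical_variance_inequality[OF n m, of m'] empirical_variance_inequality[OF n m', of m]
    by (simp add: dist_commute[of m' m])
  also have "\<dots> = 1 / real n * (\<Sum>i = 1..n. (dist m' (xs i))\<^sup>2 - (dist m (xs i))\<^sup>2
      - (dist m' (ys i))\<^sup>2 + (dist m (ys i))\<^sup>2)"
    by (simp add: empirical_risk_def sum.distrib sum_subtractf algebra_simps diff_divide_distrib add_divide_distrib)
  also have "\<dots> \<le> 1 / real n * (\<Sum>i = 1..n. 2 * dist (xs i) (ys i) * dist m' m)"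
    by (intro mult_left_mono sum_mono quadruple) auto
  also have "\<dots> = 2 * S * dist m m'"
    by (simp add: S_def sum_distrib_left sum_distrib_right dist_commute algebra_simps)
  finally have "dist m m' * dist m m' \<le> S * dist m m'"
    by (simp add: power2_eq_square)
  moreover have "0 \<le> S"
    by (simp add: S_def sum_nonneg)
  ultimately show ?thesis
    unfolding S_def[symmetric] by (cases "dist m m' = 0") (auto simp: mult_le_cancel_right)
qed

lemma empirical_barycenter_unique:
  fixes xs :: "nat \<Rightarrow> 'a::hadamard_space"
  assumes "n \<ge> 1" "is_empirical_barycenter n xs m" "is_empirical_barycenter n xs m'"
  shows "m = m'"
  using empirical_barycenter_lipschitz[OF assms] by simp

text \<open>\<open>is_barycenter\<close> compares extended integrals; finite second moments allow
  the passage to real ones, in which the CAT(0) inequality can be integrated.\<close>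

lemma barycenter_variance_inequality:
  fixes mu :: "'a::hadamard_space measure"
  assumes "prob_space mu" and int: "\<And>q. integrable mu (\<lambda>x. (dist q x)\<^sup>2)"
    and m: "is_barycenter mu m"
  shows "(dist m q)\<^sup>2 \<le> (\<integral>x. (dist q x)\<^sup>2 \<partial>mu) - (\<integral>x. (dist m x)\<^sup>2 \<partial>mu)"
proof (rule variance_inequality)
  interpret prob_space mu by fact
  show "strongly_convex (\<lambda>q. \<integral>x. (dist q x)\<^sup>2 \<partial>mu)"
    unfolding strongly_convex_def
  proof (intro allI impI)
    fix l :: real and x y z :: 'a
    assume l: "0 \<le> l" "l \<le> 1" and z: "intermediate l x y z"
    have "(\<integral>p. (dist z p)\<^sup>2 \<partial>mu) \<le>
        (\<integral>p. (1 - l) * (dist x p)\<^sup>2 + l * (dist y p)\<^sup>2 - l * (1 - l) * (dist x y)\<^sup>2 \<partial>mu)"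
      by (intro integral_mono dist_intermediate[OF l z] Bochner_Integration.integrable_diff
          Bochner_Integration.integrable_add integrable_mult_right int integrable_const)
    also have "\<dots> = (1 - l) * (\<integral>p. (dist x p)\<^sup>2 \<partial>mu) + l * (\<integral>p. (dist y p)\<^sup>2 \<partial>mu)
        - l * (1 - l) * (dist x y)\<^sup>2"
      by (simp add: int prob_space)
    finally show "(\<integral>p. (dist z p)\<^sup>2 \<partial>mu) \<le> (1 - l) * (\<integral>p. (dist x p)\<^sup>2 \<partial>mu)
        + l * (\<integral>p. (dist y p)\<^sup>2 \<partial>mu) - l * (1 - l) * (dist x y)\<^sup>2" .
  qed
  show "(\<integral>x. (dist m x)\<^sup>2 \<partial>mu) \<le> (\<integral>x. (dist q x)\<^sup>2 \<partial>mu)" for q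
  proof -
    have "(\<integral>\<^sup>+ x. ennreal ((dist m x)\<^sup>2) \<partial>mu) \<le> (\<integral>\<^sup>+ x. ennreal ((dist q x)\<^sup>2) \<partial>mu)"
      using m by (simp add: is_barycenter_def is_arg_min_def not_less)
    then show ?thesis
      by (simp add: nn_integral_eq_integral int)
  qed
qed

section \<open>Measurable versions of Lipschitz functions\<close>

text \<open>A substitute for the distance that is measurable for the product of the Borel
  sigma-algebras; it is the distance as soon as one of the points lies in the closure of \<open>D\<close>.\<close>

definition sep_dist :: "'a::metric_space set \<Rightarrow> 'a \<Rightarrow> 'a \<Rightarrow> real" where
  "sep_dist D x y = (SUP d\<in>D. \<bar>dist x d - dist y d\<bar>)"

lemma abs_dist_diff_bound: "\<bar>dist x d - dist y d\<bar> \<le> dist x (y::'a::metric_space)"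
  by metric

lemma bdd_above_sep_dist: "bdd_above ((\<lambda>d. \<bar>dist x d - dist y d\<bar>) ` D)"
  using abs_dist_diff_bound by (auto intro!: bdd_aboveI[of _ "dist x y"])

lemma sep_dist_upper: "d \<in> D \<Longrightarrow> \<bar>dist x d - dist y d\<bar> \<le> sep_dist D x y"
  unfolding sep_dist_def by (rule cSUP_upper[OF _ bdd_above_sep_dist])

lemma sep_dist_le_dist: "D \<noteq> {} \<Longrightarrow> sep_dist D x y \<le> dist x y"
  unfolding sep_dist_def by (intro cSUP_least abs_dist_diff_bound)

lemma sep_dist_nonneg: "D \<noteq> {} \<Longrightarrow> 0 \<le> sep_dist D x y"
  using sep_dist_upper[of _ D x y] by (meson abs_ge_zero ex_in_conv order_trans)

lemma sep_dist_refl [simp]: "D \<noteq> {} \<Longrightarrow> sep_dist D x x = 0"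
  by (simp add: sep_dist_def)

lemma sep_dist_commute: "sep_dist D x y = sep_dist D y x"
  by (simp add: sep_dist_def abs_minus_commute)

text \<open>For \<open>d\<close> in \<open>D\<close> close to \<open>x\<close>,
  \<open>dist x d\<close> is nearly 0 and \<open>dist y d\<close> nearly
  \<open>dist x y\<close>.\<close>

lemma sep_dist_eq_dist:
  assumes "x \<in> closure D"
  shows "sep_dist D x y = dist x y"
proof (rule antisym)
  have "D \<noteq> {}"
    using assms by auto
  then show "sep_dist D x y \<le> dist x y"
    by (rule sep_dist_le_dist)
  show "dist x y \<le> sep_dist D x y"
  proof (rule field_le_epsilon)
    fix e :: real assume "0 < e"
    then obtain d where d: "d \<in> D" "dist d x < e / 2"
      using assms unfolding closure_approachable by (meson half_gt_zero)
    have "dist x y \<le> \<bar>dist x d - dist y d\<bar> + 2 * dist d x"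
      by metric
    with d sep_dist_upper[OF d(1), of x y] show "dist x y \<le> sep_dist D x y + e"
      by simp
  qed
qed

text \<open>Every supremand is built from continuous functions of a single point, so no joint Borel
  sigma-algebra is involved, and the supremum is countable.\<close>

lemma borel_measurable_sep_dist [measurable (raw)]:
  assumes [measurable]: "f \<in> M \<rightarrow>\<^sub>M borel" "g \<in> M \<rightarrow>\<^sub>M borel" and "countable D"
  shows "(\<lambda>x. sep_dist D (f x) (g x)) \<in> borel_measurable M"
  unfolding sep_dist_def
proof (rule borel_measurable_cSUP[OF \<open>countable D\<close> _ bdd_above_sep_dist])
  have [measurable]: "(\<lambda>x. dist x d) \<in> borel_measurable borel" for d :: 'b
    by (intro borel_measurable_continuous_onI continuous_intros)
  show "(\<lambda>x. \<bar>dist (f x) d - dist (g x) d\<bar>) \<in> borel_measurable M" for d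
    by measurable
qed

text \<open>The witness is the McShane extension with the infimum restricted to a countable set,
  which makes it measurable although the ambient space need not be separable.\<close>

lemma lipschitz_measurable_version:
  fixes f :: "('i \<Rightarrow> 'a::metric_space) \<Rightarrow> real" and mu :: "'a measure"
  assumes sets: "sets mu = sets borel" and I: "finite I" and D: "countable D" "D \<noteq> {}"
    and L: "0 \<le> L" and lip: "\<And>x y. \<bar>f x - f y\<bar> \<le> L * (\<Sum>i\<in>I. dist (x i) (y i))"
  obtains g where "g \<in> borel_measurable (PiM I (\<lambda>_. mu))"
    and "\<And>x. (\<And>i. i \<in> I \<Longrightarrow> x i \<in> closure D) \<Longrightarrow> g x = f x"
    and "\<And>x y. \<bar>g x - g y\<bar> \<le> L * (\<Sum>i\<in>I. sep_dist D (x i) (y i))"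
proof
  define E where "E = PiE I (\<lambda>_. D)"
  define h where "h e x = f e + L * (\<Sum>i\<in>I. dist (x i) (e i))" for e x
  define g where "g x = (INF e\<in>E. h e x)" for x
  have E: "countable E" "E \<noteq> {}"
    using I D by (auto simp: E_def PiE_eq_empty_iff intro: countable_PiE)
  have ED: "e i \<in> D" if "e \<in> E" "i \<in> I" for e i
    using that by (auto simp: E_def)
  have h_ge: "f x \<le> h e x" for e x
    using lip[of x e] by (auto simp: h_def abs_le_iff)
  have bdd: "bdd_below ((\<lambda>e. h e x) ` E)" for x
    using h_ge by (auto intro!: bdd_belowI[of _ "f x"])
  have [measurable]: "(\<lambda>x. dist x d) \<in> borel_measurable mu" for d
    unfolding measurable_cong_sets[OF sets refl]
    by (intro borel_measurable_continuous_onI continuous_intros)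
  show "g \<in> borel_measurable (PiM I (\<lambda>_. mu))"
    unfolding g_def
  proof (rule borel_measurable_cINF[OF E(1) _ bdd])
    show "h e \<in> borel_measurable (PiM I (\<lambda>_. mu))" for e
      unfolding h_def by measurable
  qed
  show "g x = f x" if x: "\<And>i. i \<in> I \<Longrightarrow> x i \<in> closure D" for x
  proof (rule antisym)
    show "f x \<le> g x"
      unfolding g_def by (intro cINF_greatest E h_ge)
    show "g x \<le> f x"
    proof (rule field_le_epsilon)
      fix e :: real assume e: "0 < e"
      \<comment> \<open>Small enough for a total error \<open>2 * L * card I * r\<close> of at most
        \<open>e\<close>; the added ones keep the denominator positive when \<open>L = 0\<close> or
        \<open>I\<close> is empty.\<close>
      define r where "r = e / (2 * (L + 1) * (card I + 1))"
      have r: "0 < r"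
        using e L by (simp add: r_def)
      have "\<exists>d\<in>D. dist d (x i) < r" if "i \<in> I" for i
        using x[OF that] r unfolding closure_approachable by blast
      then obtain p where p: "\<And>i. i \<in> I \<Longrightarrow> p i \<in> D" "\<And>i. i \<in> I \<Longrightarrow> dist (p i) (x i) < r"
        by metis
      define q where "q = restrict p I"
      have q: "q \<in> E" "\<And>i. i \<in> I \<Longrightarrow> dist (x i) (q i) \<le> r"
        using p by (auto simp: q_def E_def dist_commute less_imp_le)
      have "g x \<le> h q x"
        unfolding g_def by (rule cINF_lower[OF bdd q(1)])
      also have "\<dots> \<le> f x + 2 * (L * (\<Sum>i\<in>I. dist (x i) (q i)))"
        using lip[of x q] by (auto simp: h_def abs_le_iff)
      also have "\<dots> \<le> f x + 2 * (L * (\<Sum>i\<in>I. r))"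
        using q L by (intro add_left_mono mult_left_mono sum_mono) auto
      also have "\<dots> \<le> f x + 2 * ((L + 1) * ((card I + 1) * r))"
        using L r by (auto intro!: mult_mono)
      also have "2 * ((L + 1) * ((card I + 1) * r)) = e"
        using L by (simp add: r_def divide_simps)
      finally show "g x \<le> f x + e" .
    qed
  qed
  \<comment> \<open>The cones \<open>h e\<close> are centred at points of \<open>D\<close>, so their
    differences are controlled by \<open>sep_dist\<close>. The resulting oscillation bound is
    measurable and holds at all points.\<close>
  have le: "g x - g y \<le> L * (\<Sum>i\<in>I. sep_dist D (x i) (y i))" for x y
  proof -
    have "g x - L * (\<Sum>i\<in>I. sep_dist D (x i) (y i)) \<le> h e y" if "e \<in> E" for e
    proof -
      have "g x \<le> h e x"
        unfolding g_def by (rule cINF_lower[OF bdd that])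
      moreover have "h e x - h e y = L * (\<Sum>i\<in>I. dist (x i) (e i) - dist (y i) (e i))"
        by (simp add: h_def sum_subtractf algebra_simps)
      moreover have "\<dots> \<le> L * (\<Sum>i\<in>I. sep_dist D (x i) (y i))"
        using sep_dist_upper[OF ED[OF that]] L
        by (intro mult_left_mono sum_mono) (auto simp: abs_le_iff)
      ultimately show ?thesis by linarith
    qed
    then have "g x - L * (\<Sum>i\<in>I. sep_dist D (x i) (y i)) \<le> g y"
      unfolding g_def[of y] by (intro cINF_greatest E)
    then show ?thesis by simp
  qed
  show "\<bar>g x - g y\<bar> \<le> L * (\<Sum>i\<in>I. sep_dist D (x i) (y i))" for x y
    using le[of x y] le[of y x] by (simp add: abs_le_iff sep_dist_commute[of D "y _"])
qed

section \<open>Bounded differences with exponential moments\<close>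

text \<open>Turns a bound on the \<open>cosh\<close> moment of the oscillation into integrability of
  the oscillation itself.\<close>

lemma le_cosh: "t \<le> cosh (t::real)"
proof (cases "0 \<le> t")
  case True
  have "0 \<le> (t - 1)\<^sup>2"
    by simp
  then have "2 * t \<le> 1 + t + t\<^sup>2 / 2"
    by (simp add: power2_eq_square algebra_simps)
  also have "\<dots> \<le> exp t"
    using True by (rule exp_lower_Taylor_quadratic)
  also have "\<dots> \<le> 2 * cosh t"
    by (simp add: cosh_def)
  finally show ?thesis by simp
qed (use cosh_real_ge_1[of t] in linarith)

lemma borel_measurable_cosh [measurable]: "(cosh :: real \<Rightarrow> real) \<in> borel_measurable borel"
  by (intro borel_measurable_continuous_onI continuous_intros)

lemma ennreal_integral_le:
  fixes f :: "'a \<Rightarrow> real"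
  assumes "integrable M f"
  shows "ennreal (\<integral>x. f x \<partial>M) \<le> (\<integral>\<^sup>+x. f x \<partial>M)"
proof -
  have "ennreal (\<integral>x. f x \<partial>M) \<le> ennreal (\<integral>x. max 0 (f x) \<partial>M)"
    using assms by (intro ennreal_leI integral_mono) auto
  also have "\<dots> = (\<integral>\<^sup>+x. max 0 (f x) \<partial>M)"
    using assms by (intro nn_integral_eq_integral[symmetric]) auto
  also have "\<dots> = (\<integral>\<^sup>+x. f x \<partial>M)"
    by (intro nn_integral_cong) (auto simp: max_def ennreal_neg)
  finally show ?thesis .
qed

text \<open>Jensen's inequality, in tangent-line form, replaces the mean by an independent copy;
  exchanging the two points then averages \<open>exp\<close> to \<open>cosh\<close>.\<close>

lemma (in prob_space) exp_centered_le_symmetrized: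
  fixes u :: "'a \<Rightarrow> real"
  assumes [measurable]: "u \<in> borel_measurable M" and int: "integrable M u"
  shows "(\<integral>\<^sup>+x. exp (u x - expectation u) \<partial>M) \<le> (\<integral>\<^sup>+x. \<integral>\<^sup>+y. cosh (u x - u y) \<partial>M \<partial>M)"
proof -
  interpret MM: pair_prob_space M M ..
  have "ennreal (exp (u x - expectation u)) \<le> (\<integral>\<^sup>+y. exp (u x - u y) \<partial>M)" for x
  proof -
    \<comment> \<open>The tangent of \<open>exp\<close> at 0 in the variable
      \<open>expectation u - u y\<close>; its mean is 1, also when the exponential has infinite
      mean.\<close>
    have "ennreal (exp (u x - expectation u)) =
        ennreal (\<integral>y. exp (u x - expectation u) * (1 + expectation u - u y) \<partial>M)"
      using int by (simp add: prob_space)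
    also have "\<dots> \<le> (\<integral>\<^sup>+y. exp (u x - expectation u) * (1 + expectation u - u y) \<partial>M)"
      using int by (intro ennreal_integral_le) auto
    also have "\<dots> \<le> (\<integral>\<^sup>+y. exp (u x - u y) \<partial>M)"
    proof (intro nn_integral_mono ennreal_leI)
      fix y
      have "1 + (expectation u - u y) \<le> exp (expectation u - u y)"
        by (rule exp_ge_add_one_self)
      then have "1 + expectation u - u y \<le> exp (expectation u - u y)"
        by (simp only: add_diff_eq)
      then have "exp (u x - expectation u) * (1 + expectation u - u y) \<le>
          exp (u x - expectation u) * exp (expectation u - u y)"
        by (intro mult_left_mono) auto
      then show "exp (u x - expectation u) * (1 + expectation u - u y) \<le> exp (u x - u y)"
        by (simp add: exp_add[symmetric])
    qed
    finally show ?thesis .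
  qed
  then have le: "(\<integral>\<^sup>+x. exp (u x - expectation u) \<partial>M) \<le> (\<integral>\<^sup>+x. \<integral>\<^sup>+y. exp (u x - u y) \<partial>M \<partial>M)"
    by (intro nn_integral_mono)
  define J where "J = (\<integral>\<^sup>+x. \<integral>\<^sup>+y. exp (u x - u y) / 2 \<partial>M \<partial>M)"
  have swap: "J = (\<integral>\<^sup>+x. \<integral>\<^sup>+y. exp (u y - u x) / 2 \<partial>M \<partial>M)"
    unfolding J_def by (rule MM.Fubini') measurable
  have "(\<integral>\<^sup>+x. \<integral>\<^sup>+y. cosh (u x - u y) \<partial>M \<partial>M) =
      (\<integral>\<^sup>+x. \<integral>\<^sup>+y. ennreal (exp (u x - u y) / 2) + ennreal (exp (u y - u x) / 2) \<partial>M \<partial>M)"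
    by (intro nn_integral_cong) (simp add: cosh_def add_divide_distrib ennreal_plus)
  also have "\<dots> = J + J"
    by (subst (2) swap) (simp add: nn_integral_add J_def)
  also have "\<dots> = (\<integral>\<^sup>+x. \<integral>\<^sup>+y. ennreal (exp (u x - u y) / 2) + ennreal (exp (u x - u y) / 2) \<partial>M \<partial>M)"
    by (simp add: nn_integral_add J_def)
  also have "\<dots> = (\<integral>\<^sup>+x. \<integral>\<^sup>+y. exp (u x - u y) \<partial>M \<partial>M)"
    by (intro nn_integral_cong) (subst ennreal_plus[symmetric], auto)
  finally show ?thesis
    using le by simp
qed

text \<open>Integrating out one coordinate keeps the oscillation bound for the others, and that
  coordinate costs one factor \<open>K\<close>. Integrability is carried through the induction
  because \<open>h\<close> may be unbounded and the centering requires it.\<close>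

lemma exponential_bounded_differences:
  fixes f :: "('i \<Rightarrow> 'a) \<Rightarrow> real" and h :: "'a \<Rightarrow> 'a \<Rightarrow> real"
  assumes "prob_space mu" and I: "finite I"
    and h[measurable]: "(\<lambda>(x, y). h x y) \<in> borel_measurable (mu \<Otimes>\<^sub>M mu)"
    and K: "(\<integral>\<^sup>+x. \<integral>\<^sup>+y. cosh (h x y) \<partial>mu \<partial>mu) \<le> ennreal K"
    and f: "f \<in> borel_measurable (PiM I (\<lambda>_. mu))"
    and diff: "\<And>i x y. i \<in> I \<Longrightarrow> x \<in> space (PiM I (\<lambda>_. mu)) \<Longrightarrow> y \<in> space mu \<Longrightarrow>
       \<bar>f x - f (x(i := y))\<bar> \<le> h (x i) y"
  shows "integrable (PiM I (\<lambda>_. mu)) f \<and>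
    (\<integral>\<^sup>+x. exp (f x - (\<integral>x. f x \<partial>PiM I (\<lambda>_. mu))) \<partial>PiM I (\<lambda>_. mu)) \<le> ennreal K ^ card I"
  using I f diff
proof (induction I arbitrary: f rule: finite_induct)
  case empty
  then show ?case
    by (simp add: PiM_empty integrable_count_space lebesgue_integral_count_space_finite
        nn_integral_count_space_finite)
next
  case (insert i I)
  interpret mu: prob_space mu by fact
  interpret prod: product_sigma_finite "\<lambda>_. mu" ..
  note [measurable] = insert.prems(1)
  define P where "P = PiM I (\<lambda>_. mu)"
  interpret PI: prob_space P unfolding P_def by (intro prob_space_PiM mu.prob_space_axioms)
  define Q where "Q = PiM (insert i I) (\<lambda>_. mu)"
  have spaceQ: "x(i := y) \<in> space Q" if "x \<in> space P" "y \<in> space mu" for x y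
    using that by (auto simp: P_def Q_def space_PiM PiE_iff extensional_def)
  have upd [measurable]: "(\<lambda>(x, y). x(i := y)) \<in> P \<Otimes>\<^sub>M mu \<rightarrow>\<^sub>M Q"
    unfolding P_def Q_def by (rule measurable_add_dim)
  have [measurable]: "f \<in> borel_measurable Q"
    by (simp add: Q_def)
  have f_upd [measurable]: "(\<lambda>(x, y). f (x(i := y))) \<in> borel_measurable (P \<Otimes>\<^sub>M mu)"
    using measurable_compose[OF upd \<open>f \<in> borel_measurable Q\<close>] by (simp add: case_prod_beta')
  define g where "g x = (\<integral>y. f (x(i := y)) \<partial>mu)" for x
  have g_meas [measurable]: "g \<in> borel_measurable P"
    unfolding g_def by measurable
  have step: "\<bar>f (x(i := y)) - f (x(i := z))\<bar> \<le> h y z" if "x \<in> space P" "y \<in> space mu" "z \<in> space mu"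
    for x y z
    using insert.prems(2)[of i "x(i := y)" z] spaceQ[OF that(1,2)] that
    by (simp add: Q_def fun_upd_def cong: if_cong)
  have h_le: "h x y \<le> cosh (h x y)" for x y
    by (rule le_cosh)
  have fin: "(\<integral>\<^sup>+x. \<integral>\<^sup>+y. cosh (h x y) \<partial>mu \<partial>mu) < \<infinity>"
    using K by (simp add: le_less_trans)
  have "AE x in mu. (\<integral>\<^sup>+y. cosh (h x y) \<partial>mu) \<noteq> \<infinity>"
    using fin by (intro nn_integral_PInf_AE) auto
  \<comment> \<open>A reference point: \<open>cosh (h z y)\<close> plus a constant dominates every
    section of \<open>f\<close>.\<close>
  then obtain z where z: "z \<in> space mu" "(\<integral>\<^sup>+y. cosh (h z y) \<partial>mu) \<noteq> \<infinity>"
    using eventually_happens'[OF mu.ae_filter_bot AE_conjI[OF AE_space]] by blast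
  have int_y: "integrable mu (\<lambda>y. f (x(i := y)))" if x: "x \<in> space P" for x
  proof (rule Bochner_Integration.integrable_bound)
    have "integrable mu (\<lambda>y. cosh (h z y))"
      using z by (intro integrableI_nonneg) (auto simp: top.not_eq_extremum)
    then show "integrable mu (\<lambda>y. \<bar>f (x(i := z))\<bar> + cosh (h z y))"
      by simp
    show "(\<lambda>y. f (x(i := y))) \<in> borel_measurable mu"
      using measurable_compose[OF measurable_Pair1'[OF x] f_upd] by simp
    show "AE y in mu. norm (f (x(i := y))) \<le> norm (\<bar>f (x(i := z))\<bar> + cosh (h z y))"
      using step[OF x z(1)] h_le[of z] by (intro AE_I2) (smt (verit) real_norm_def)
  qed
  have g_diff: "\<bar>g x - g (x(j := y))\<bar> \<le> h (x j) y" if j: "j \<in> I" and x: "x \<in> space P" and y: "y \<in> space mu" for j x y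
  proof -
    have x': "x(j := y) \<in> space P"
      using j x y by (auto simp: P_def space_PiM PiE_iff extensional_def)
    have "\<bar>g x - g (x(j := y))\<bar> = \<bar>\<integral>v. f (x(i := v)) - f (x(j := y, i := v)) \<partial>mu\<bar>"
      using int_y[OF x] int_y[OF x'] by (simp add: g_def)
    also have "\<dots> \<le> (\<integral>v. \<bar>f (x(i := v)) - f (x(j := y, i := v))\<bar> \<partial>mu)"
      by (rule integral_abs_bound)
    also have "\<dots> \<le> (\<integral>v. h (x j) y \<partial>mu)"
    proof (rule integral_mono)
      fix v assume v: "v \<in> space mu"
      have "j \<noteq> i"
        using j insert.hyps by auto
      have "\<bar>f (x(i := v)) - f ((x(i := v))(j := y))\<bar> \<le> h ((x(i := v)) j) y"
        by (rule insert.prems(2)) (use j y spaceQ[OF x v] in \<open>simp_all only: Q_def insert_iff simp_thms\<close>)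
      then show "\<bar>f (x(i := v)) - f (x(j := y, i := v))\<bar> \<le> h (x j) y"
        using \<open>j \<noteq> i\<close> fun_upd_twist[OF \<open>j \<noteq> i\<close>, of x y v] by (simp only: fun_upd_other not_False_eq_True)
    qed (use int_y[OF x] int_y[OF x'] in auto)
    finally show ?thesis by (simp add: mu.prob_space)
  qed
  have IH: "integrable P g" "(\<integral>\<^sup>+x. exp (g x - (\<integral>x. g x \<partial>P)) \<partial>P) \<le> ennreal K ^ card I"
    using insert.IH[OF g_meas[unfolded P_def] g_diff[unfolded P_def]] by (simp_all only: P_def)
  have one: "(\<integral>\<^sup>+y. exp (f (x(i := y)) - g x) \<partial>mu) \<le> ennreal K" if x: "x \<in> space P" for x
  proof -
    have "(\<integral>\<^sup>+y. exp (f (x(i := y)) - g x) \<partial>mu) \<le>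
        (\<integral>\<^sup>+y. \<integral>\<^sup>+v. cosh (f (x(i := y)) - f (x(i := v))) \<partial>mu \<partial>mu)"
      unfolding g_def using int_y[OF x] by (intro mu.exp_centered_le_symmetrized) auto
    also have "\<dots> \<le> (\<integral>\<^sup>+y. \<integral>\<^sup>+v. cosh (h y v) \<partial>mu \<partial>mu)"
    proof (intro nn_integral_mono ennreal_leI)
      fix y v assume "y \<in> space mu" "v \<in> space mu"
      with step[OF x this] show "cosh (f (x(i := y)) - f (x(i := v))) \<le> cosh (h y v)"
        by (metis abs_ge_zero cosh_real_abs cosh_real_nonneg_le_iff order_trans)
    qed
    finally show ?thesis using K by (rule order_trans)
  qed
  \<comment> \<open>The mean deviation of a section from \<open>g x\<close> is at most
    \<open>K\<close>, so integrability of \<open>g\<close> carries over to \<open>f\<close>.\<close>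
  have abs_one: "(\<integral>\<^sup>+y. \<bar>f (x(i := y))\<bar> \<partial>mu) \<le> ennreal \<bar>g x\<bar> + ennreal K" if x: "x \<in> space P" for x
  proof -
    note iy = int_y[OF x]
    have "(\<integral>\<^sup>+y. \<bar>f (x(i := y))\<bar> \<partial>mu) \<le> (\<integral>\<^sup>+y. ennreal \<bar>g x\<bar> + ennreal (\<integral>v. \<bar>f (x(i := y)) - f (x(i := v))\<bar> \<partial>mu) \<partial>mu)"
    proof (intro nn_integral_mono)
      fix y
      have "f (x(i := y)) - g x = (\<integral>v. f (x(i := y)) - f (x(i := v)) \<partial>mu)"
        using iy by (simp add: g_def mu.prob_space)
      then have "\<bar>f (x(i := y)) - g x\<bar> \<le> (\<integral>v. \<bar>f (x(i := y)) - f (x(i := v))\<bar> \<partial>mu)"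
        by (simp add: integral_abs_bound)
      then have "\<bar>f (x(i := y))\<bar> \<le> \<bar>g x\<bar> + (\<integral>v. \<bar>f (x(i := y)) - f (x(i := v))\<bar> \<partial>mu)"
        by linarith
      from ennreal_leI[OF this]
      show "ennreal \<bar>f (x(i := y))\<bar> \<le> ennreal \<bar>g x\<bar> + ennreal (\<integral>v. \<bar>f (x(i := y)) - f (x(i := v))\<bar> \<partial>mu)"
        by simp
    qed
    also have "\<dots> = ennreal \<bar>g x\<bar> + (\<integral>\<^sup>+y. \<integral>\<^sup>+v. \<bar>f (x(i := y)) - f (x(i := v))\<bar> \<partial>mu \<partial>mu)"
      using iy by (subst nn_integral_add)
        (auto simp: mu.emeasure_space_1 nn_integral_eq_integral intro!: nn_integral_cong)
    also have "(\<integral>\<^sup>+y. \<integral>\<^sup>+v. \<bar>f (x(i := y)) - f (x(i := v))\<bar> \<partial>mu \<partial>mu) \<le> (\<integral>\<^sup>+y. \<integral>\<^sup>+v. cosh (h y v) \<partial>mu \<partial>mu)"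
      using step[OF x] h_le by (intro nn_integral_mono ennreal_leI) (meson order_trans)
    finally show ?thesis using K by (meson add_left_mono order_trans)
  qed
  have intQ: "integrable Q f"
  proof (rule integrableI_bounded)
    have "(\<integral>\<^sup>+x. norm (f x) \<partial>Q) = (\<integral>\<^sup>+x. \<integral>\<^sup>+y. \<bar>f (x(i := y))\<bar> \<partial>mu \<partial>P)"
      unfolding Q_def P_def using insert.hyps
      by (subst prod.product_nn_integral_insert) (auto simp: Q_def[symmetric])
    also have "\<dots> \<le> (\<integral>\<^sup>+x. ennreal \<bar>g x\<bar> + ennreal K \<partial>P)"
      by (intro nn_integral_mono abs_one)
    also have "\<dots> = (\<integral>\<^sup>+x. ennreal \<bar>g x\<bar> \<partial>P) + ennreal K"
      by (simp add: nn_integral_add PI.emeasure_space_1)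
    also have "\<dots> < \<infinity>"
      using IH(1) by (simp add: integrable_iff_bounded)
    finally show "(\<integral>\<^sup>+x. norm (f x) \<partial>Q) < \<infinity>" .
  qed simp
  have mean: "(\<integral>x. f x \<partial>Q) = (\<integral>x. g x \<partial>P)"
    unfolding Q_def P_def g_def using insert.hyps intQ
    by (intro prod.product_integral_insert) (auto simp: Q_def)
  have "(\<integral>\<^sup>+x. exp (f x - (\<integral>x. f x \<partial>Q)) \<partial>Q) =
      (\<integral>\<^sup>+x. \<integral>\<^sup>+y. exp (f (x(i := y)) - (\<integral>x. g x \<partial>P)) \<partial>mu \<partial>P)"
    unfolding mean unfolding Q_def P_def using insert.hyps
    by (subst prod.product_nn_integral_insert) (auto simp: Q_def[symmetric] P_def[symmetric])
  \<comment> \<open>The exponent is split at \<open>g x\<close>; its first part does not depend on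
    \<open>y\<close>.\<close>
  also have "\<dots> = (\<integral>\<^sup>+x. exp (g x - (\<integral>x. g x \<partial>P)) * (\<integral>\<^sup>+y. exp (f (x(i := y)) - g x) \<partial>mu) \<partial>P)"
  proof (intro nn_integral_cong)
    fix x assume x: "x \<in> space P"
    have [measurable]: "(\<lambda>y. f (x(i := y))) \<in> borel_measurable mu"
      using int_y[OF x] by auto
    show "(\<integral>\<^sup>+y. exp (f (x(i := y)) - (\<integral>x. g x \<partial>P)) \<partial>mu) =
        exp (g x - (\<integral>x. g x \<partial>P)) * (\<integral>\<^sup>+y. exp (f (x(i := y)) - g x) \<partial>mu)"
      by (subst nn_integral_cmult[symmetric])
        (auto simp: ennreal_mult[symmetric] exp_add[symmetric])
  qed
  also have "\<dots> \<le> (\<integral>\<^sup>+x. exp (g x - (\<integral>x. g x \<partial>P)) * ennreal K \<partial>P)"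
    by (intro nn_integral_mono mult_left_mono one) auto
  also have "\<dots> = (\<integral>\<^sup>+x. exp (g x - (\<integral>x. g x \<partial>P)) \<partial>P) * ennreal K"
    by (rule nn_integral_multc) measurable
  also have "\<dots> \<le> ennreal K ^ card I * ennreal K"
    using IH(2) by (rule mult_right_mono) simp
  finally show ?case
    using intQ insert.hyps by (simp add: Q_def mult.commute)
qed

section \<open>Exponential moments at small scales and tail bounds\<close>

lemma cosh_scale_le:
  fixes s v :: real
  assumes s: "0 \<le> s" "s \<le> 1"
  shows "cosh (s * v) \<le> 1 - s\<^sup>2 + s\<^sup>2 * cosh v"
proof (rule sums_le)
  show "(\<lambda>n. if even n then (s * v) ^ n /\<^sub>R fact n else 0) sums cosh (s * v)"
    by (rule cosh_converges)
  \<comment> \<open>The series are compared term by term: \<open>s ^ n <= s^2\<close> for even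
    \<open>n >= 2\<close>, and the correction at \<open>n = 0\<close> restores the constant term
    1.\<close>
  show "(\<lambda>n. (if n = 0 then 1 - s\<^sup>2 else 0) + s\<^sup>2 * (if even n then v ^ n /\<^sub>R fact n else 0)) sums
      (1 - s\<^sup>2 + s\<^sup>2 * cosh v)"
    by (intro sums_add sums_mult cosh_converges sums_single[of 0 "\<lambda>_. 1 - s\<^sup>2"])
  show "(if even n then (s * v) ^ n /\<^sub>R fact n else 0) \<le>
      (if n = 0 then 1 - s\<^sup>2 else 0) + s\<^sup>2 * (if even n then v ^ n /\<^sub>R fact n else 0)" for n
  proof (cases "even n \<and> n \<noteq> 0")
    case True
    then have "2 \<le> n"
      by (auto elim!: evenE)
    then have "s ^ n \<le> s\<^sup>2"
      using s by (intro power_decreasing) auto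
    moreover have "0 \<le> v ^ n"
      using True by (simp add: zero_le_even_power)
    ultimately have "s ^ n * v ^ n \<le> s\<^sup>2 * v ^ n"
      by (rule mult_right_mono)
    then show ?thesis
      using True by (simp add: power_mult_distrib divide_right_mono divide_inverse_commute[symmetric])
  qed auto
qed

lemma cosh_scale_le_exp:
  fixes s v :: real
  assumes "0 \<le> s" "s \<le> 1" "0 \<le> v"
  shows "cosh (s * v) \<le> (1 - s\<^sup>2 / 2) + s\<^sup>2 / 2 * exp v"
proof -
  have "cosh v \<le> (1 + exp v) / 2"
    using assms by (simp add: cosh_def)
  then have "s\<^sup>2 * cosh v \<le> s\<^sup>2 * ((1 + exp v) / 2)"
    by (intro mult_left_mono) auto
  then show ?thesis
    using cosh_scale_le[OF assms(1,2), of v] by (simp add: algebra_simps add_divide_distrib)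
qed

text \<open>As the exponential moment is at most 2, the convex combination from
  \<open>cosh_scale_le_exp\<close> becomes \<open>1 + s^2 / 2\<close>; its exponential majorant
  multiplies well over the coordinates.\<close>

lemma nn_integral_cosh_scale_le:
  fixes h :: "'a \<Rightarrow> 'a \<Rightarrow> real"
  assumes "prob_space mu"
    and h[measurable]: "(\<lambda>(x, y). h x y) \<in> borel_measurable (mu \<Otimes>\<^sub>M mu)"
    and nonneg: "\<And>x y. 0 \<le> h x y" and c: "0 < c"
    and exp_h: "(\<integral>\<^sup>+x. \<integral>\<^sup>+y. exp (h x y / c) \<partial>mu \<partial>mu) \<le> 2"
    and s: "0 \<le> s" "s \<le> 1"
  shows "(\<integral>\<^sup>+x. \<integral>\<^sup>+y. cosh (s * h x y / c) \<partial>mu \<partial>mu) \<le> ennreal (exp (s\<^sup>2 / 2))"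
proof -
  interpret prob_space mu by fact
  have s2: "s\<^sup>2 \<le> 1"
    using s by (simp add: power_le_one)
  have "(\<integral>\<^sup>+x. \<integral>\<^sup>+y. cosh (s * h x y / c) \<partial>mu \<partial>mu) \<le>
      (\<integral>\<^sup>+x. \<integral>\<^sup>+y. ennreal (1 - s\<^sup>2 / 2) + ennreal (s\<^sup>2 / 2) * ennreal (exp (h x y / c)) \<partial>mu \<partial>mu)"
  proof (intro nn_integral_mono)
    fix x y
    have "ennreal (cosh (s * h x y / c)) \<le> ennreal ((1 - s\<^sup>2 / 2) + s\<^sup>2 / 2 * exp (h x y / c))"
      using cosh_scale_le_exp[OF s, of "h x y / c"] nonneg c by (intro ennreal_leI) simp
    also have "\<dots> = ennreal (1 - s\<^sup>2 / 2) + ennreal (s\<^sup>2 / 2) * ennreal (exp (h x y / c))"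
      using s2 by (subst ennreal_plus) (auto simp: ennreal_mult[symmetric])
    finally show "ennreal (cosh (s * h x y / c)) \<le>
        ennreal (1 - s\<^sup>2 / 2) + ennreal (s\<^sup>2 / 2) * ennreal (exp (h x y / c))" .
  qed
  also have "\<dots> = ennreal (1 - s\<^sup>2 / 2) +
      ennreal (s\<^sup>2 / 2) * (\<integral>\<^sup>+x. \<integral>\<^sup>+y. exp (h x y / c) \<partial>mu \<partial>mu)"
  proof -
    have [measurable]: "h x \<in> borel_measurable mu" if "x \<in> space mu" for x
      using measurable_compose[OF measurable_Pair1'[OF that] h] by simp
    have "(\<integral>\<^sup>+x. \<integral>\<^sup>+y. ennreal (1 - s\<^sup>2 / 2) + ennreal (s\<^sup>2 / 2) * ennreal (exp (h x y / c)) \<partial>mu \<partial>mu) =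
        (\<integral>\<^sup>+x. ennreal (1 - s\<^sup>2 / 2) + ennreal (s\<^sup>2 / 2) * (\<integral>\<^sup>+y. exp (h x y / c) \<partial>mu) \<partial>mu)"
      by (intro nn_integral_cong)
        (simp add: nn_integral_add nn_integral_cmult emeasure_space_1)
    then show ?thesis
      by (simp add: nn_integral_add nn_integral_cmult emeasure_space_1)
  qed
  also have "\<dots> \<le> ennreal (1 - s\<^sup>2 / 2) + ennreal (s\<^sup>2 / 2) * ennreal 2"
    using exp_h by (intro add_left_mono mult_left_mono) auto
  also have "\<dots> = ennreal (1 + s\<^sup>2 / 2)"
    using s2 by (subst ennreal_mult[symmetric], simp, simp, subst ennreal_plus[symmetric]) auto
  also have "\<dots> \<le> ennreal (exp (s\<^sup>2 / 2))"
    by (intro ennreal_leI exp_ge_add_one_self)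
  finally show ?thesis .
qed

lemma (in prob_space) exponential_Markov:
  assumes [measurable]: "u \<in> borel_measurable M"
    and "(\<integral>\<^sup>+x. exp (u x) \<partial>M) \<le> ennreal (exp b)"
  shows "prob {x\<in>space M. b + l \<le> u x} \<le> exp (- l)"
proof -
  have "emeasure M {x\<in>space M. b + l \<le> u x} =
      emeasure M ({x\<in>space M. 1 \<le> ennreal (exp (- b - l)) * ennreal (exp (u x))})"
    by (intro arg_cong[of _ _ "emeasure M"] Collect_cong conj_cong refl)
      (auto simp: ennreal_mult[symmetric] exp_add[symmetric] simp flip: ennreal_1)
  also have "\<dots> \<le> ennreal (exp (- b - l)) * (\<integral>\<^sup>+x. exp (u x) \<partial>M)"
    using nn_integral_Markov_inequality[of "\<lambda>x. ennreal (exp (u x))" "space M" M "ennreal (exp (- b - l))"]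
    by (simp cong: nn_integral_cong_simp)
  also have "\<dots> \<le> ennreal (exp (- b - l)) * ennreal (exp b)"
    by (intro mult_left_mono assms) auto
  also have "\<dots> = ennreal (exp (- l))"
    by (simp add: ennreal_mult[symmetric] exp_add[symmetric])
  finally show ?thesis
    by (simp add: emeasure_eq_measure)
qed

text \<open>Scale \<open>s\<close> gives the deviation \<open>c * (s / 2 + l / (s * n))\<close> with
  failure probability at most \<open>exp (- l)\<close>; what remains is the choice of
  \<open>s\<close> in \<open>(0, 1]\<close>.\<close>

lemma subexponential_concentration:
  fixes f :: "('i \<Rightarrow> 'a) \<Rightarrow> real" and h :: "'a \<Rightarrow> 'a \<Rightarrow> real"
  assumes mu: "prob_space mu" and I: "finite I" "card I = n" "n \<ge> 1"
    and h: "(\<lambda>(x, y). h x y) \<in> borel_measurable (mu \<Otimes>\<^sub>M mu)"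
    and nonneg: "\<And>x y. 0 \<le> h x y" and c: "0 < c"
    and exp_h: "(\<integral>\<^sup>+x. \<integral>\<^sup>+y. exp (h x y / c) \<partial>mu \<partial>mu) \<le> 2"
    and f[measurable]: "f \<in> borel_measurable (PiM I (\<lambda>_. mu))"
    and diff: "\<And>i x y. i \<in> I \<Longrightarrow> \<bar>f x - f (x(i := y))\<bar> \<le> 1 / real n * h (x i) y"
    and l: "0 < l"
  shows "integrable (PiM I (\<lambda>_. mu)) f \<and>
    measure (PiM I (\<lambda>_. mu)) {x\<in>space (PiM I (\<lambda>_. mu)).
        f x \<le> (\<integral>x. f x \<partial>PiM I (\<lambda>_. mu)) + c * (2 * sqrt (l / n) + l / n)} \<ge> 1 - exp (- l)"
proof -
  interpret mu: prob_space mu by fact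
  define P where "P = PiM I (\<lambda>_. mu)"
  interpret P: prob_space P
    unfolding P_def by (intro prob_space_PiM mu)
  \<comment> \<open>Without the cap the optimum would be \<open>sqrt (2 * l / n)\<close>; the
    simpler value costs \<open>3 / 2 * sqrt (l / n)\<close>, still below the claimed coefficient
    2.\<close>
  define s where "s = min 1 (sqrt (l / n))"
  have s: "0 < s" "s \<le> 1"
    using l I by (auto simp: s_def)
  \<comment> \<open>Normalises the oscillation \<open>1 / n * h\<close> of \<open>f\<close> to
    \<open>s * h / c\<close>.\<close>
  define a where "a = s * n / c"
  have a: "0 < a"
    using s c I by (simp add: a_def)
  have *: "integrable P (\<lambda>x. a * f x) \<and>
    (\<integral>\<^sup>+x. exp (a * f x - (\<integral>x. a * f x \<partial>P)) \<partial>P) \<le> ennreal (exp (s\<^sup>2 / 2)) ^ card I"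
    unfolding P_def
  proof (rule exponential_bounded_differences[OF mu I(1)])
    show "(\<lambda>(x, y). s * h x y / c) \<in> borel_measurable (mu \<Otimes>\<^sub>M mu)"
      using h by (simp add: case_prod_beta')
    show "(\<integral>\<^sup>+x. \<integral>\<^sup>+y. cosh (s * h x y / c) \<partial>mu \<partial>mu) \<le> ennreal (exp (s\<^sup>2 / 2))"
      using s by (intro nn_integral_cosh_scale_le mu h nonneg c exp_h) auto
    show "\<bar>a * f x - a * f (x(i := y))\<bar> \<le> s * h (x i) y / c" if "i \<in> I" for i x y
    proof -
      have "a * \<bar>f x - f (x(i := y))\<bar> \<le> a * (1 / real n * h (x i) y)"
        using a diff[OF that] by (intro mult_left_mono) auto
      also have "\<dots> = s * h (x i) y / c"
        using I by (simp add: a_def)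
      finally show ?thesis
        using a by (simp add: abs_mult right_diff_distrib[symmetric])
    qed
  qed simp
  define E where "E = (\<integral>x. f x \<partial>P)"
  have int: "integrable P f"
    using * a by simp
  have [measurable]: "f \<in> borel_measurable P"
    by (simp add: P_def)
  have "ennreal (exp (s\<^sup>2 / 2)) ^ card I = ennreal (exp (n * (s\<^sup>2 / 2)))"
    by (simp only: I(2) exp_of_nat_mult ennreal_power exp_ge_zero)
  moreover have "a * f x - (\<integral>x. a * f x \<partial>P) = a * (f x - E)" for x
    by (simp add: E_def right_diff_distrib)
  ultimately have "(\<integral>\<^sup>+x. exp (a * (f x - E)) \<partial>P) \<le> ennreal (exp (n * (s\<^sup>2 / 2)))"
    using * by (simp only:)
  then have tail: "P.prob {x\<in>space P. n * (s\<^sup>2 / 2) + l \<le> a * (f x - E)} \<le> exp (- l)"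
    by (intro P.exponential_Markov) auto
  define r where "r = c * (2 * sqrt (l / n) + l / n)"
  have "s * n * (s / 2) + l \<le> s * n * (2 * sqrt (l / n) + l / n)"
  proof (cases "sqrt (l / n) \<le> 1")
    case True
    then have "s = sqrt (l / n)"
      by (simp add: s_def)
    then have "s\<^sup>2 = l / n"
      using l by simp
    then have "l = s * n * s"
      using I by (simp add: power2_eq_square field_simps)
    then have "s * n * (s / 2) + l = 3 / 2 * (s * n * s)"
      by simp
    also have "\<dots> \<le> 2 * (s * n * s)"
      using s by (intro mult_right_mono) auto
    also have "\<dots> \<le> s * n * (2 * s) + s * n * (l / n)"
      using s l by simp
    finally show ?thesis
      unfolding \<open>s = sqrt (l / n)\<close>[symmetric] by (simp only: distrib_left)
  next
    case False
    then have "s = 1" by (simp add: s_def)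
    \<comment> \<open>Here \<open>l > n\<close>, and the surplus \<open>1 / 2\<close> is absorbed by
      the square-root term.\<close>
    have "real n * (1 / 2) \<le> real n * (2 * sqrt (l / n))"
      using False by (intro mult_left_mono) linarith+
    then show ?thesis
      using \<open>s = 1\<close> I by (simp add: algebra_simps)
  qed
  then have ar: "n * (s\<^sup>2 / 2) + l \<le> a * r"
  proof -
    have "a * r = s * n * (2 * sqrt (l / n) + l / n)"
      using c by (simp add: a_def r_def)
    moreover have "n * (s\<^sup>2 / 2) = s * n * (s / 2)"
      by (simp add: power2_eq_square)
    ultimately show ?thesis
      using \<open>s * n * (s / 2) + l \<le> _\<close> by (simp only:)
  qed
  have "1 - exp (- l) \<le> 1 - P.prob {x\<in>space P. n * (s\<^sup>2 / 2) + l \<le> a * (f x - E)}"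
    using tail by simp
  also have "\<dots> = P.prob (space P - {x\<in>space P. n * (s\<^sup>2 / 2) + l \<le> a * (f x - E)})"
    by (rule P.prob_compl[symmetric]) measurable
  also have "\<dots> \<le> P.prob {x\<in>space P. f x \<le> E + r}"
  proof (rule P.finite_measure_mono)
    show "space P - {x\<in>space P. n * (s\<^sup>2 / 2) + l \<le> a * (f x - E)} \<subseteq> {x\<in>space P. f x \<le> E + r}"
    proof safe
      fix x assume "\<not> n * (s\<^sup>2 / 2) + l \<le> a * (f x - E)"
      then have "a * (f x - E) \<le> a * r"
        using ar by linarith
      then show "f x \<le> E + r"
        using a by simp
    qed
  qed measurable
  finally show ?thesis
    using int by (simp add: P_def E_def r_def)
qed

section \<open>Stability of the empirical barycenter\<close>

lemma AE_PiM_all: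
  assumes "prob_space mu" "finite I" "AE x in mu. P x"
  shows "AE x in PiM I (\<lambda>_. mu). \<forall>i\<in>I. P (x i)"
  using assms by (intro AE_finite_allI AE_PiM_component)

lemma nn_integral_PiM_component:
  assumes "prob_space mu" "i \<in> I" "f \<in> borel_measurable mu"
  shows "(\<integral>\<^sup>+x. f (x i) \<partial>PiM I (\<lambda>_. mu)) = (\<integral>\<^sup>+x. f x \<partial>mu)"
proof -
  have "(\<integral>\<^sup>+x. f x \<partial>mu) = (\<integral>\<^sup>+x. f x \<partial>distr (PiM I (\<lambda>_. mu)) mu (\<lambda>x. x i))"
    using assms(1,2) by (subst distr_PiM_component) auto
  also have "\<dots> = (\<integral>\<^sup>+x. f (x i) \<partial>PiM I (\<lambda>_. mu))"
    using assms by (intro nn_integral_distr) auto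
  finally show ?thesis by simp
qed

text \<open>Coordinate 0 carries a spare independent point and the sample occupies the others; the
  swap trades sample point \<open>i\<close> for the spare one. The restriction keeps the result in
  the product space.\<close>

definition swap0 :: "nat \<Rightarrow> nat \<Rightarrow> (nat \<Rightarrow> 'a) \<Rightarrow> nat \<Rightarrow> 'a" where
  "swap0 n i x = (\<lambda>k\<in>{0..n}. x (Transposition.transpose 0 i k))"

lemma transpose_le: "i \<le> n \<Longrightarrow> k \<le> n \<Longrightarrow> Transposition.transpose (0::nat) i k \<le> n"
  by (auto simp: Transposition.transpose_def)

lemma distr_swap0:
  assumes "prob_space mu" "i \<le> n"
  shows "distr (PiM {0..n} (\<lambda>_. mu)) (PiM {0..n} (\<lambda>_. mu)) (swap0 n i) = PiM {0..n} (\<lambda>_. mu)"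
  unfolding swap0_def
  by (rule distr_PiM_reindex) (use assms transpose_le[of i n] in \<open>auto intro!: inj_onI dest: transpose_eq_imp_eq\<close>)

lemma measurable_swap0 [measurable]:
  "i \<le> n \<Longrightarrow> swap0 n i \<in> PiM {0..n} (\<lambda>_. mu) \<rightarrow>\<^sub>M PiM {0..n} (\<lambda>_. mu)"
  unfolding swap0_def
  by (intro measurable_restrict measurable_component_singleton) (auto dest: transpose_le)

lemma nn_integral_swap0:
  assumes "prob_space mu" "i \<le> n" "f \<in> borel_measurable (PiM {0..n} (\<lambda>_. mu))"
  shows "(\<integral>\<^sup>+x. f (swap0 n i x) \<partial>PiM {0..n} (\<lambda>_. mu)) = (\<integral>\<^sup>+x. f x \<partial>PiM {0..n} (\<lambda>_. mu))"
  using nn_integral_distr[OF measurable_swap0[OF assms(2), of mu], of f] assms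
  by (simp add: distr_swap0)

lemma is_empirical_barycenter_cong:
  assumes "\<And>i. i \<in> {1..n} \<Longrightarrow> xs i = ys i"
  shows "is_empirical_barycenter n xs m \<longleftrightarrow> is_empirical_barycenter n ys m"
proof -
  have "empirical_risk n xs = empirical_risk n ys"
    unfolding empirical_risk_def using assms by (auto intro!: ext sum.cong)
  then show ?thesis
    by (simp add: is_empirical_barycenter_iff)
qed

text \<open>Here \<open>U i\<close> is the mean squared distance of the empirical barycenter to
  sample point \<open>i\<close>, \<open>U 0\<close> that to a fresh point, \<open>Fm\<close> the
  optimal risk and \<open>rho\<close> the mean squared error. Both \<open>2 * n * rho\<close> and
  \<open>V\<close> are compared with \<open>n * U 0\<close> minus the sum of the \<open>U i\<close>;
  finiteness must be secured before anything cancels.\<close>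

lemma stability_arithmetic:
  fixes U :: "nat \<Rightarrow> ennreal" and V Fm :: real
  assumes n: "n \<ge> 1" and V: "0 \<le> V"
    and main: "ennreal (2 * real n) * rho + of_nat n * ennreal Fm + (\<Sum>i = 1..n. U i) \<le>
      of_nat n * U 0 + of_nat n * ennreal Fm"
    and sum_le: "(\<Sum>i = 1..n. U i) \<le> of_nat n * ennreal Fm"
    and stability: "\<And>i. i \<in> {1..n} \<Longrightarrow> 2 * U 0 \<le> 2 * U i + ennreal (2 / n) * ennreal V"
  shows "rho \<le> ennreal (V / (2 * real n))"
proof -
  note sum_le
  also have Fm_fin: "of_nat n * ennreal Fm < \<top>"
    by (simp add: ennreal_mult_less_top ennreal_of_nat_eq_real_of_nat)
  finally have sum_fin: "(\<Sum>i = 1..n. U i) < \<top>" .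
  have U_fin: "U i < \<top>" if "i \<in> {1..n}" for i
  proof -
    have "U i \<le> (\<Sum>i = 1..n. U i)"
      using that by (intro member_le_sum) auto
    then show ?thesis
      using sum_fin by (rule le_less_trans)
  qed
  have "2 * U 0 \<le> 2 * U 1 + ennreal (2 / n) * ennreal V"
    using n by (intro stability) auto
  also have "\<dots> < \<top>"
    using U_fin[of 1] n by (simp add: ennreal_mult_less_top)
  finally have U0_fin: "U 0 < \<top>"
    by (auto simp: ennreal_mult_less_top)
  have "U i < \<top>" if "i \<in> {0..n}" for i
    using that U0_fin U_fin[of i] by (cases "i = 0") auto
  then have "\<exists>a\<ge>0. U i = ennreal a" if "i \<in> {0..n}" for i
    using that by (simp add: less_top_ennreal)
  then obtain a where a: "\<And>i. i \<in> {0..n} \<Longrightarrow> 0 \<le> a i" "\<And>i. i \<in> {0..n} \<Longrightarrow> U i = ennreal (a i)"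
    by metis
  have st: "a 0 \<le> a i + V / n" if i: "i \<in> {1..n}" for i
  proof -
    have "0 \<le> 2 / real n * V"
      using V by simp
    moreover have "2 * U 0 = ennreal (2 * a 0)" "2 * U i = ennreal (2 * a i)"
      using a[of 0] a[of i] i by (simp_all add: ennreal_mult)
    moreover have "ennreal (2 / n) * ennreal V = ennreal (2 / n * V)"
      using V by (simp only: ennreal_mult zero_le_divide_iff of_nat_0_le_iff zero_le_numeral simp_thms)
    ultimately have "ennreal (2 * a 0) \<le> ennreal (2 * a i + 2 / n * V)"
      using stability[OF i] a(1)[of i] i by (simp only: ennreal_plus) simp
    then have "2 * a 0 \<le> 2 * a i + 2 / n * V"
      using a(1)[of i] i \<open>0 \<le> 2 / real n * V\<close> by (subst (asm) ennreal_le_iff) auto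
    then show ?thesis by simp
  qed
  then have "(\<Sum>i = 1..n. a 0) \<le> (\<Sum>i = 1..n. a i + V / n)"
    by (intro sum_mono) auto
  then have st_sum: "n * a 0 \<le> (\<Sum>i = 1..n. a i) + V"
    using n by (simp add: sum.distrib)
  have sumU: "(\<Sum>i = 1..n. U i) = ennreal (\<Sum>i = 1..n. a i)"
    using a by (subst sum_ennreal[symmetric]) auto
  have "of_nat n * ennreal Fm + (ennreal (2 * real n) * rho + (\<Sum>i = 1..n. U i)) \<le>
      of_nat n * ennreal Fm + of_nat n * U 0"
    using main by (simp only: ac_simps)
  then have "ennreal (2 * real n) * rho + (\<Sum>i = 1..n. U i) \<le> of_nat n * U 0"
    using Fm_fin by (auto simp only: ennreal_add_left_cancel_le infinity_ennreal_def less_irrefl)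
  also have "\<dots> = ennreal (n * a 0)"
    using a[of 0] by (simp add: ennreal_mult ennreal_of_nat_eq_real_of_nat)
  also have "\<dots> \<le> ennreal ((\<Sum>i = 1..n. a i) + V)"
    using st_sum by (rule ennreal_leI)
  also have "\<dots> = ennreal V + (\<Sum>i = 1..n. U i)"
    using V a sumU by (subst ennreal_plus) (auto intro!: sum_nonneg simp: add.commute)
  finally have "(\<Sum>i = 1..n. U i) + ennreal (2 * real n) * rho \<le> (\<Sum>i = 1..n. U i) + ennreal V"
    by (simp only: ac_simps)
  then have fin: "ennreal (2 * real n) * rho \<le> ennreal V"
    unfolding sumU by (simp only: ennreal_add_left_cancel_le) simp
  have "rho = ennreal (1 / (2 * real n)) * (ennreal (2 * real n) * rho)"
    using n by (simp add: mult.assoc[symmetric] ennreal_mult[symmetric] del: ennreal_1) simp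
  also have "\<dots> \<le> ennreal (1 / (2 * real n)) * ennreal V"
    by (intro mult_left_mono fin) simp
  also have "\<dots> = ennreal (V / (2 * real n))"
    using V by (simp add: ennreal_mult[symmetric])
  finally show ?thesis .
qed

text \<open>\<open>B\<close> selects a barycenter for every sequence, so it can be evaluated at
  updated and swapped samples. \<open>V\<close> bounds the second moment of the distance of two
  independent points through its measurable substitute.\<close>

locale sampled_barycenter =
  fixes mu :: "'a::hadamard_space measure" and D :: "'a set" and n :: nat and m :: 'a
    and B :: "(nat \<Rightarrow> 'a) \<Rightarrow> 'a" and V :: real
  assumes mu: "prob_space mu" and sets_mu: "sets mu = sets borel"
    and D: "countable D" "AE x in mu. x \<in> closure D"
    and n: "n \<ge> 1"
    and m: "is_barycenter mu m"
    and B: "\<And>x. is_empirical_barycenter n x (B x)"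
    and V: "0 \<le> V" "(\<integral>\<^sup>+x. \<integral>\<^sup>+y. (sep_dist D x y)\<^sup>2 \<partial>mu \<partial>mu) \<le> ennreal V"
begin

sublocale mu: prob_space mu by (rule mu)

lemma D_nonempty: "D \<noteq> {}"
proof
  assume "D = {}"
  with D(2) show False by simp
qed

lemma measurable_mu: "f \<in> borel \<rightarrow>\<^sub>M N \<Longrightarrow> f \<in> mu \<rightarrow>\<^sub>M N"
  by (simp add: measurable_cong_sets[OF sets_mu refl])

lemma id_mu [measurable]: "(\<lambda>x. x) \<in> mu \<rightarrow>\<^sub>M borel"
  by (rule measurable_mu) simp

lemma dist_mu [measurable]: "(\<lambda>x. dist q x) \<in> borel_measurable mu"
  by (intro measurable_mu borel_measurable_continuous_onI continuous_intros)

lemma sep_dist_mu [measurable]: "(\<lambda>(x, y). sep_dist D x y) \<in> borel_measurable (mu \<Otimes>\<^sub>M mu)"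
proof -
  have "(\<lambda>p. sep_dist D (fst p) (snd p)) \<in> borel_measurable (mu \<Otimes>\<^sub>M mu)"
    by (intro borel_measurable_sep_dist measurable_compose[OF measurable_fst id_mu]
        measurable_compose[OF measurable_snd id_mu] D)
  then show ?thesis by (simp add: case_prod_beta')
qed

text \<open>A finite double integral yields one point \<open>z\<close> of \<open>closure D\<close>
  with finite second moment about it; the triangle inequality moves this to any centre.\<close>

lemma integrable_dist_square: "integrable mu (\<lambda>x. (dist q x)\<^sup>2)"
proof -
  have [measurable]: "(\<lambda>y. sep_dist D x y) \<in> borel_measurable mu" if "x \<in> space mu" for x
    using measurable_compose[OF measurable_Pair1'[OF that] sep_dist_mu] by simp
  have "(\<integral>\<^sup>+x. \<integral>\<^sup>+y. (sep_dist D x y)\<^sup>2 \<partial>mu \<partial>mu) \<noteq> \<infinity>"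
    using V by (auto simp: top_unique)
  then have "AE x in mu. (\<integral>\<^sup>+y. (sep_dist D x y)\<^sup>2 \<partial>mu) \<noteq> \<infinity>"
    by (intro nn_integral_PInf_AE) auto
  then obtain z where z: "z \<in> closure D" "(\<integral>\<^sup>+y. (sep_dist D z y)\<^sup>2 \<partial>mu) \<noteq> \<infinity>"
    using eventually_happens'[OF mu.ae_filter_bot AE_conjI[OF D(2)]] by blast
  have *: "integrable mu (\<lambda>x. (dist z x)\<^sup>2)"
    using z by (intro integrableI_nonneg) (auto simp: sep_dist_eq_dist top.not_eq_extremum)
  show ?thesis
  proof (rule Bochner_Integration.integrable_bound)
    show "integrable mu (\<lambda>x. 2 * (dist q z)\<^sup>2 + 2 * (dist z x)\<^sup>2)"
      using * by simp
    have "(dist q x)\<^sup>2 \<le> 2 * (dist q z)\<^sup>2 + 2 * (dist z x)\<^sup>2" for x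
    proof -
      have "(dist q x)\<^sup>2 \<le> (dist q z + dist z x)\<^sup>2"
        by (intro power_mono dist_triangle) simp
      also have "\<dots> \<le> 2 * (dist q z)\<^sup>2 + 2 * (dist z x)\<^sup>2"
        using sum_squares_bound[of "dist q z" "dist z x"] by (simp add: power2_sum)
      finally show ?thesis .
    qed
    then show "AE x in mu. norm ((dist q x)\<^sup>2) \<le> norm (2 * (dist q z)\<^sup>2 + 2 * (dist z x)\<^sup>2)"
      by simp
  qed simp
qed

lemma B_lipschitz: "dist (B x) (B y) \<le> 1 / real n * (\<Sum>i = 1..n. dist (x i) (y i))"
  by (rule empirical_barycenter_lipschitz[OF n B B])

lemma B_cong: "(\<And>i. i \<in> {1..n} \<Longrightarrow> x i = y i) \<Longrightarrow> B x = B y"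
  using empirical_barycenter_unique[OF n B] B is_empirical_barycenter_cong[of n x y] by metis

lemma dist_B_swap0:
  assumes "i \<in> {1..n}"
  shows "dist (B x) (B (swap0 n i x)) \<le> 1 / real n * dist (x 0) (x i)"
proof -
  have "(\<Sum>k = 1..n. dist (x k) (swap0 n i x k)) = (\<Sum>k\<in>{i}. dist (x k) (swap0 n i x k))"
    using assms by (intro sum.mono_neutral_right) (auto simp: swap0_def Transposition.transpose_def)
  also have "\<dots> = dist (x 0) (x i)"
    using assms by (auto simp: swap0_def dist_commute)
  finally show ?thesis
    using B_lipschitz[of x "swap0 n i x"] by simp
qed

text \<open>Exchanging a sample point with an independent copy moves the empirical barycenter by
  at most one \<open>n\<close>-th of their distance, so the in-sample and out-of-sample risks of the empirical
  barycenter are close. The variance inequalities bound the distance of the two barycenters by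
  the difference of these risks.\<close>

lemma second_moment_bound:
  fixes R :: "(nat \<Rightarrow> 'a) \<Rightarrow> real"
  assumes R [measurable]: "R \<in> borel_measurable (PiM {1..n} (\<lambda>_. mu))"
    and R_eq: "\<And>x. (\<And>i. i \<in> {1..n} \<Longrightarrow> x i \<in> closure D) \<Longrightarrow> R x = dist m (B x)"
  shows "(\<integral>\<^sup>+x. (R x)\<^sup>2 \<partial>PiM {1..n} (\<lambda>_. mu)) \<le> ennreal (V / (2 * real n))"
proof -
  interpret prod: product_sigma_finite "\<lambda>_. mu" ..
  define Q where "Q = PiM {0..n} (\<lambda>_. mu)"
  define N where "N = PiM {1..n} (\<lambda>_. mu)"
  have ins: "insert 0 {1..n} = {0..n}"
    by auto
  interpret Q: prob_space Q
    unfolding Q_def by (intro prob_space_PiM mu)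
  interpret N: prob_space N
    unfolding N_def by (intro prob_space_PiM mu)
  have comp_Q [measurable]: "(\<lambda>x. x i) \<in> Q \<rightarrow>\<^sub>M mu" if "i \<le> n" for i
    unfolding Q_def using that by (intro measurable_component_singleton) auto
  have split: "(\<integral>\<^sup>+x. f x \<partial>Q) = (\<integral>\<^sup>+x. \<integral>\<^sup>+y. f (x(0 := y)) \<partial>mu \<partial>N)" if "f \<in> borel_measurable Q" for f
    using prod.product_nn_integral_insert[of "{1..n}" 0 f] that unfolding ins Q_def N_def by simp
  have good: "AE x in Q. \<forall>i\<in>{0..n}. x i \<in> closure D"
    unfolding Q_def using mu D by (intro AE_PiM_all) auto
  have goodN: "AE x in N. \<forall>i\<in>{1..n}. x i \<in> closure D"
    unfolding N_def using mu D by (intro AE_PiM_all) auto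
  \<comment> \<open>Index 0 stands for the fresh point, the others for sample points. The Lipschitz
    constant 2 is crude: one unit for \<open>B\<close> and one for the endpoint
    \<open>x j\<close>.\<close>
  have "\<exists>u. u \<in> borel_measurable Q \<and>
      (\<forall>x. (\<forall>i\<in>{0..n}. x i \<in> closure D) \<longrightarrow> u x = dist (B x) (x j))" if j: "j \<le> n" for j
  proof -
    have "\<bar>dist (B x) (x j) - dist (B y) (y j)\<bar> \<le> 2 * (\<Sum>i\<in>{0..n}. dist (x i) (y i))" for x y
    proof -
      have "\<bar>dist (B x) (x j) - dist (B y) (y j)\<bar> \<le> dist (B x) (B y) + dist (x j) (y j)"
        by metric
      moreover have "dist (x j) (y j) \<le> (\<Sum>i\<in>{0..n}. dist (x i) (y i))"
        using j by (intro member_le_sum) auto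
      moreover have "dist (B x) (B y) \<le> (\<Sum>i\<in>{0..n}. dist (x i) (y i))"
      proof -
        have "dist (B x) (B y) \<le> 1 / real n * (\<Sum>i\<in>{1..n}. dist (x i) (y i))"
          by (rule B_lipschitz)
        also have "\<dots> \<le> 1 * (\<Sum>i\<in>{1..n}. dist (x i) (y i))"
          using n by (intro mult_right_mono sum_nonneg) auto
        also have "\<dots> \<le> (\<Sum>i\<in>{0..n}. dist (x i) (y i))"
          by (simp, intro sum_mono2) auto
        finally show ?thesis .
      qed
      ultimately show ?thesis by simp
    qed
    then show ?thesis
      unfolding Q_def
      by (rule lipschitz_measurable_version[OF sets_mu finite_atLeastAtMost D(1) D_nonempty zero_le_numeral])
        blast
  qed
  then obtain u where u [measurable]: "\<And>j. j \<le> n \<Longrightarrow> u j \<in> borel_measurable Q"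
    and u_eq: "\<And>j x. j \<le> n \<Longrightarrow> (\<forall>i\<in>{0..n}. x i \<in> closure D) \<Longrightarrow> u j x = dist (B x) (x j)"
    by metis
  define U where "U j = (\<integral>\<^sup>+x. (u j x)\<^sup>2 \<partial>Q)" for j
  define Fm where "Fm = (\<integral>x. (dist m x)\<^sup>2 \<partial>mu)"
  have Fm: "(\<integral>\<^sup>+x. (dist m x)\<^sup>2 \<partial>mu) = ennreal Fm" "0 \<le> Fm"
    unfolding Fm_def by (simp_all add: nn_integral_eq_integral integrable_dist_square)
  have sep_Q [measurable]: "(\<lambda>x. sep_dist D (x 0) (x i)) \<in> borel_measurable Q" if "i \<le> n" for i
    using that by (intro borel_measurable_sep_dist measurable_compose[OF comp_Q id_mu] D) auto
  have sepV: "(\<integral>\<^sup>+x. (sep_dist D (x 0) (x i))\<^sup>2 \<partial>Q) \<le> ennreal V" if i: "i \<in> {1..n}" for i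
  proof -
    have [measurable]: "(\<lambda>(y, x). sep_dist D x y) \<in> borel_measurable (mu \<Otimes>\<^sub>M mu)"
      using sep_dist_mu by (simp add: sep_dist_commute[of D])
    have "(\<integral>\<^sup>+x. (sep_dist D (x 0) (x i))\<^sup>2 \<partial>Q) =
        (\<integral>\<^sup>+x. (\<lambda>z. \<integral>\<^sup>+y. (sep_dist D z y)\<^sup>2 \<partial>mu) (x i) \<partial>N)"
      using i by (subst split) (auto simp: sep_dist_commute[of D _ "_ i"])
    also have "\<dots> = (\<integral>\<^sup>+z. \<integral>\<^sup>+y. (sep_dist D z y)\<^sup>2 \<partial>mu \<partial>mu)"
      unfolding N_def using i by (intro nn_integral_PiM_component mu) auto
    finally show ?thesis using V by simp
  qed

  have stability: "2 * U 0 \<le> 2 * U i + ennreal (2 / n) * ennreal V" if i: "i \<in> {1..n}" for i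
  proof -
    have i': "i \<le> n" "0 \<le> n" using i by auto
    note [measurable] = u[OF i'(1)] u[OF i'(2)] sep_Q[OF i'(1)]
    have sw [measurable]: "swap0 n i \<in> Q \<rightarrow>\<^sub>M Q"
      unfolding Q_def using i' by measurable
    have inv: "(\<integral>\<^sup>+x. (u j (swap0 n i x))\<^sup>2 \<partial>Q) = U j" if "j \<le> n" for j
      using nn_integral_swap0[OF mu i'(1), of "\<lambda>x. ennreal ((u j x)\<^sup>2)"] u[OF that]
      by (simp add: U_def Q_def)
    \<comment> \<open>By exchangeability both summands have mean \<open>U 0\<close>. The symmetric
      form fits a quadrilateral: \<open>x i\<close> is fresh for the swapped sample and in-sample
      for \<open>x\<close>, and conversely for \<open>x 0\<close>.\<close>
    have "2 * U 0 = (\<integral>\<^sup>+x. ennreal ((u 0 (swap0 n i x))\<^sup>2) + ennreal ((u 0 x)\<^sup>2) \<partial>Q)"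
      by (simp add: nn_integral_add inv U_def[symmetric] mult_2)
    also have "\<dots> \<le> (\<integral>\<^sup>+x. ennreal ((u i x)\<^sup>2) + ennreal ((u i (swap0 n i x))\<^sup>2)
        + ennreal (2 / n) * ennreal ((sep_dist D (x 0) (x i))\<^sup>2) \<partial>Q)"
    proof (intro nn_integral_mono_AE, use good in eventually_elim)
      fix x assume x: "\<forall>i\<in>{0..n}. x i \<in> closure D"
      have tau: "swap0 n i x 0 = x i" "swap0 n i x i = x 0"
        using i by (auto simp: swap0_def)
      have x': "\<forall>k\<in>{0..n}. swap0 n i x k \<in> closure D"
        using x transpose_le[OF i'(1)] by (auto simp: swap0_def)
      have "(u 0 (swap0 n i x))\<^sup>2 + (u 0 x)\<^sup>2 \<le> (u i x)\<^sup>2 + (u i (swap0 n i x))\<^sup>2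
          + 2 * dist (x i) (x 0) * dist (B (swap0 n i x)) (B x)"
        using quadrilateral[of "B (swap0 n i x)" "x i" "B x" "x 0"]
        by (simp add: u_eq x x' tau i')
      also have "\<dots> \<le> (u i x)\<^sup>2 + (u i (swap0 n i x))\<^sup>2
          + 2 * dist (x i) (x 0) * (1 / real n * dist (x 0) (x i))"
        using dist_B_swap0[OF i, of x]
        by (intro add_left_mono mult_left_mono) (auto simp: dist_commute)
      also have "2 * dist (x i) (x 0) * (1 / real n * dist (x 0) (x i)) =
          2 / n * (sep_dist D (x 0) (x i))\<^sup>2"
        using x i by (simp add: sep_dist_eq_dist dist_commute power2_eq_square)
      finally have "ennreal ((u 0 (swap0 n i x))\<^sup>2 + (u 0 x)\<^sup>2) \<le>
          ennreal ((u i x)\<^sup>2 + (u i (swap0 n i x))\<^sup>2 + 2 / n * (sep_dist D (x 0) (x i))\<^sup>2)"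
        by (rule ennreal_leI)
      then show "ennreal ((u 0 (swap0 n i x))\<^sup>2) + ennreal ((u 0 x)\<^sup>2) \<le>
          ennreal ((u i x)\<^sup>2) + ennreal ((u i (swap0 n i x))\<^sup>2)
            + ennreal (2 / n) * ennreal ((sep_dist D (x 0) (x i))\<^sup>2)"
        by (simp only: ennreal_plus ennreal_mult zero_le_power2 add_nonneg_nonneg mult_nonneg_nonneg
            divide_nonneg_nonneg zero_le_numeral of_nat_0_le_iff)
    qed
    also have "\<dots> = 2 * U i + ennreal (2 / n) * (\<integral>\<^sup>+x. (sep_dist D (x 0) (x i))\<^sup>2 \<partial>Q)"
      using i' by (simp add: nn_integral_add nn_integral_cmult inv U_def[symmetric] mult_2)
    also have "\<dots> \<le> 2 * U i + ennreal (2 / n) * ennreal V"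
      by (intro add_left_mono mult_left_mono sepV i) simp
    finally show ?thesis .
  qed

  define rho where "rho = (\<integral>\<^sup>+x. (R x)\<^sup>2 \<partial>N)"
  define r where "r x = R (restrict x {1..n})" for x
  have r [measurable]: "r \<in> borel_measurable Q"
    unfolding r_def Q_def
    by (rule measurable_compose[OF measurable_restrict_subset R]) auto
  have rho: "rho = (\<integral>\<^sup>+x. (r x)\<^sup>2 \<partial>Q)"
  proof -
    have "restrict (x(0 := y)) {1..n} = x" if "x \<in> space N" for x y
      using that by (auto simp: N_def space_PiM PiE_iff extensional_def fun_eq_iff)
    then have "rho = (\<integral>\<^sup>+x. \<integral>\<^sup>+y. (r (x(0 := y)))\<^sup>2 \<partial>mu \<partial>N)"
      unfolding rho_def r_def by (intro nn_integral_cong) (simp add: mu.emeasure_space_1)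
    also have "\<dots> = (\<integral>\<^sup>+x. (r x)\<^sup>2 \<partial>Q)"
      by (rule split[symmetric]) measurable
    finally show ?thesis .
  qed
  \<comment> \<open>Integrating out the spare coordinate gives, almost everywhere, the population
    risk of the empirical barycenter.\<close>
  define G where "G x = (\<integral>\<^sup>+y. (u 0 (x(0 := y)))\<^sup>2 \<partial>mu)" for x
  have upd [measurable]: "(\<lambda>(x, y). x(0 := y)) \<in> Q \<Otimes>\<^sub>M mu \<rightarrow>\<^sub>M Q"
    using measurable_fun_upd[of "{0..n}" "{0..n}" 0 fst "Q \<Otimes>\<^sub>M mu" "\<lambda>_. mu" snd]
    by (simp add: Q_def insert_absorb case_prod_beta')
  have u0: "u 0 \<in> borel_measurable Q"
    using u by simp
  have "(\<lambda>(x, y). u 0 (x(0 := y))) \<in> borel_measurable (Q \<Otimes>\<^sub>M mu)"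
    using measurable_compose[OF upd u0] by (simp add: case_prod_beta')
  then have G [measurable]: "G \<in> borel_measurable Q"
    unfolding G_def by measurable
  have intG: "(\<integral>\<^sup>+x. G x \<partial>Q) = U 0"
  proof -
    have "(\<integral>\<^sup>+x. G x \<partial>Q) = (\<integral>\<^sup>+x. \<integral>\<^sup>+y. G (x(0 := y)) \<partial>mu \<partial>N)"
      by (rule split) measurable
    also have "\<dots> = (\<integral>\<^sup>+x. \<integral>\<^sup>+y. (u 0 (x(0 := y)))\<^sup>2 \<partial>mu \<partial>N)"
      by (simp add: G_def mu.emeasure_space_1)
    also have "\<dots> = U 0"
      unfolding U_def using u0 by (intro split[symmetric]) measurable
    finally show ?thesis .
  qed
  have G_eq: "AE x in Q. G x = ennreal (\<integral>y. (dist (B x) y)\<^sup>2 \<partial>mu)"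
    using good
  proof eventually_elim
    fix x assume x: "\<forall>i\<in>{0..n}. x i \<in> closure D"
    have "G x = (\<integral>\<^sup>+y. (dist (B x) y)\<^sup>2 \<partial>mu)"
      unfolding G_def
    proof (rule nn_integral_cong_AE, use D(2) in eventually_elim)
      fix y assume "y \<in> closure D"
      then have "u 0 (x(0 := y)) = dist (B (x(0 := y))) y"
        using x by (subst u_eq) auto
      also have "B (x(0 := y)) = B x"
        by (rule B_cong) auto
      finally show "ennreal ((u 0 (x(0 := y)))\<^sup>2) = ennreal ((dist (B x) y)\<^sup>2)"
        by (simp only:)
    qed
    then show "G x = ennreal (\<integral>y. (dist (B x) y)\<^sup>2 \<partial>mu)"
      by (simp add: nn_integral_eq_integral integrable_dist_square)
  qed
  have dist_m_Q [measurable]: "(\<lambda>x. dist m (x i)) \<in> borel_measurable Q" if "i \<le> n" for i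
    using measurable_compose[OF comp_Q dist_mu] that by simp
  have int_m: "(\<integral>\<^sup>+x. (dist m (x i))\<^sup>2 \<partial>Q) = ennreal Fm" if "i \<in> {1..n}" for i
    unfolding Q_def using that Fm by (subst nn_integral_PiM_component[OF mu]) auto
  have sum_m: "(\<integral>\<^sup>+x. (\<Sum>i = 1..n. ennreal ((dist m (x i))\<^sup>2)) \<partial>Q) = of_nat n * ennreal Fm"
    by (subst nn_integral_sum) (auto simp: int_m)
  have sum_u: "(\<integral>\<^sup>+x. (\<Sum>i = 1..n. ennreal ((u i x)\<^sup>2)) \<partial>Q) = (\<Sum>i = 1..n. U i)"
    by (subst nn_integral_sum) (auto simp: U_def u)

  have risk: "empirical_risk n x (B x) = 1 / n * (\<Sum>i = 1..n. (u i x)\<^sup>2)"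
    if "\<forall>i\<in>{0..n}. x i \<in> closure D" for x
    using that by (simp add: empirical_risk_def u_eq)
  \<comment> \<open>This is \<open>n\<close> times the sum of the population variance inequality at
    \<open>B x\<close> and the empirical one at \<open>m\<close>, arranged so that only sums of
    nonnegative terms occur.\<close>
  have pointwise: "AE x in Q. ennreal (2 * real n) * ennreal ((r x)\<^sup>2) + of_nat n * ennreal Fm
      + (\<Sum>i = 1..n. ennreal ((u i x)\<^sup>2)) \<le> of_nat n * G x + (\<Sum>i = 1..n. ennreal ((dist m (x i))\<^sup>2))"
    using good G_eq
  proof eventually_elim
    fix x assume x: "\<forall>i\<in>{0..n}. x i \<in> closure D"
      and Gx: "G x = ennreal (\<integral>y. (dist (B x) y)\<^sup>2 \<partial>mu)"
    define g where "g = (\<integral>y. (dist (B x) y)\<^sup>2 \<partial>mu)"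
    have g: "0 \<le> g" by (simp add: g_def)
    have "r x = dist m (B (restrict x {1..n}))"
      unfolding r_def using x by (intro R_eq) auto
    also have "B (restrict x {1..n}) = B x"
      by (rule B_cong) auto
    finally have rx: "r x = dist m (B x)" .
    have "2 * (r x)\<^sup>2 \<le> (g - Fm) + (empirical_risk n x m - empirical_risk n x (B x))"
      using empirical_variance_inequality[OF n B, of x m]
        barycenter_variance_inequality[OF mu integrable_dist_square m, of "B x"]
      by (simp add: rx g_def Fm_def dist_commute)
    also have "\<dots> = g - Fm + (1 / n * (\<Sum>i = 1..n. (dist m (x i))\<^sup>2) - 1 / n * (\<Sum>i = 1..n. (u i x)\<^sup>2))"
      by (simp add: risk[OF x]) (simp add: empirical_risk_def)
    finally have "n * (2 * (r x)\<^sup>2) \<le>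
        n * (g - Fm + (1 / n * (\<Sum>i = 1..n. (dist m (x i))\<^sup>2) - 1 / n * (\<Sum>i = 1..n. (u i x)\<^sup>2)))"
      by (intro mult_left_mono) auto
    then have "2 * real n * (r x)\<^sup>2 + n * Fm + (\<Sum>i = 1..n. (u i x)\<^sup>2) \<le> n * g + (\<Sum>i = 1..n. (dist m (x i))\<^sup>2)"
      using n by (simp add: algebra_simps)
    from ennreal_leI[OF this]
    show "ennreal (2 * real n) * ennreal ((r x)\<^sup>2) + of_nat n * ennreal Fm + (\<Sum>i = 1..n. ennreal ((u i x)\<^sup>2))
        \<le> of_nat n * G x + (\<Sum>i = 1..n. ennreal ((dist m (x i))\<^sup>2))"
      using Fm(2) g
      by (simp add: Gx g_def[symmetric] sum_nonneg ennreal_mult ennreal_of_nat_eq_real_of_nat sum_ennreal)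
  qed
  have [measurable]: "\<And>i. i \<in> {1..n} \<Longrightarrow> u i \<in> borel_measurable Q"
    using u by simp
  have "ennreal (2 * real n) * rho + of_nat n * ennreal Fm + (\<Sum>i = 1..n. U i) \<le>
      of_nat n * U 0 + of_nat n * ennreal Fm"
  proof -
    have "ennreal (2 * real n) * rho + of_nat n * ennreal Fm + (\<Sum>i = 1..n. U i) =
      (\<integral>\<^sup>+x. ennreal (2 * real n) * ennreal ((r x)\<^sup>2) + of_nat n * ennreal Fm
      + (\<Sum>i = 1..n. ennreal ((u i x)\<^sup>2)) \<partial>Q)"
      by (simp add: nn_integral_add nn_integral_cmult rho Q.emeasure_space_1 sum_u
          del: sum_ennreal One_nat_def)
    also have "\<dots> \<le> (\<integral>\<^sup>+x. of_nat n * G x + (\<Sum>i = 1..n. ennreal ((dist m (x i))\<^sup>2)) \<partial>Q)"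
      using pointwise by (rule nn_integral_mono_AE)
    also have "\<dots> = of_nat n * U 0 + of_nat n * ennreal Fm"
      by (simp add: nn_integral_add nn_integral_cmult intG sum_m del: sum_ennreal One_nat_def)
    finally show ?thesis .
  qed
  \<comment> \<open>Minimality of \<open>B x\<close> against \<open>m\<close>, the source of
    finiteness for the in-sample terms.\<close>
  moreover have "(\<Sum>i = 1..n. U i) \<le> of_nat n * ennreal Fm"
    unfolding sum_u[symmetric] sum_m[symmetric]
  proof (intro nn_integral_mono_AE, use good in eventually_elim)
    fix x assume x: "\<forall>i\<in>{0..n}. x i \<in> closure D"
    have "empirical_risk n x (B x) \<le> empirical_risk n x m"
      using B[of x] by (simp add: is_empirical_barycenter_iff)
    then have "(\<Sum>i = 1..n. (u i x)\<^sup>2) \<le> (\<Sum>i = 1..n. (dist m (x i))\<^sup>2)"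
      using n by (simp add: risk[OF x] empirical_risk_def[of n x m] divide_right_mono_neg divide_le_cancel)
    then show "(\<Sum>i = 1..n. ennreal ((u i x)\<^sup>2)) \<le> (\<Sum>i = 1..n. ennreal ((dist m (x i))\<^sup>2))"
      by (simp add: sum_ennreal ennreal_leI)
  qed
  ultimately have "rho \<le> ennreal (V / (2 * real n))"
    by (rule stability_arithmetic[where U = U, OF n V(1)]) (rule stability)
  then show ?thesis
    by (simp add: rho_def N_def)
qed

end

section \<open>Deviation of the empirical barycenter\<close>

text \<open>The distance to the empirical barycenter is only known to agree almost everywhere with a
  measurable function, which suffices after completion.\<close>

lemma borel_measurable_completion_AE:
  fixes f g :: "'a \<Rightarrow> real"
  assumes g: "g \<in> borel_measurable M" and eq: "AE x in M. f x = g x"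
  shows "f \<in> borel_measurable (completion M)"
proof (rule measurableI)
  fix A :: "real set" assume A: "A \<in> sets borel"
  show "f -` A \<inter> space (completion M) \<in> sets (completion M)"
  proof (rule completion.in_sets_AE)
    show "g -` A \<inter> space M \<in> sets (completion M)"
      using g A by auto
    show "AE x in completion M. x \<in> g -` A \<inter> space M \<longleftrightarrow> x \<in> f -` A \<inter> space (completion M)"
      using AE_completion[OF eq] by eventually_elim auto
  qed auto
qed simp

lemma (in prob_space) AE_pair_fst:
  assumes "AE x in M. P x" "{x\<in>space M. P x} \<in> sets M"
  shows "AE p in M \<Otimes>\<^sub>M M. P (fst p)"
proof -
  interpret pair_prob_space M M ..
  have "{p \<in> space (M \<Otimes>\<^sub>M M). P (fst p)} = {x\<in>space M. P x} \<times> space M"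
    by (auto simp: space_pair_measure)
  then show ?thesis
    using assms by (intro AE_pair_measure) auto
qed

text \<open>An admissible \<open>c\<close> serves twice: it bounds the second moment and hence the
  mean of \<open>R\<close>, and it is the scale of the concentration around that mean.\<close>

lemma barycenter_deviation:
  fixes mu :: "'a::hadamard_space measure" and R :: "(nat \<Rightarrow> 'a) \<Rightarrow> real"
  assumes mu: "prob_space mu" and sets_mu: "sets mu = sets borel"
    and D: "countable D" "AE x in mu. x \<in> closure D"
    and n: "n \<ge> 1" and m: "is_barycenter mu m" and B: "\<And>x. is_empirical_barycenter n x (B x)"
    and c: "0 < c" "(\<integral>\<^sup>+p. exp (\<bar>case p of (x, y) \<Rightarrow> dist x y\<bar> / c) \<partial>(mu \<Otimes>\<^sub>M mu)) \<le> 2"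
    and R: "R \<in> borel_measurable (PiM {1..n} (\<lambda>_. mu))"
    and R_eq: "\<And>x. (\<And>i. i \<in> {1..n} \<Longrightarrow> x i \<in> closure D) \<Longrightarrow> R x = dist m (B x)"
    and R_lip: "\<And>x y. \<bar>R x - R y\<bar> \<le> 1 / real n * (\<Sum>i\<in>{1..n}. sep_dist D (x i) (y i))"
  shows "(\<integral>\<^sup>+x. (R x)\<^sup>2 \<partial>PiM {1..n} (\<lambda>_. mu)) \<le> ennreal (c\<^sup>2 / n)" (is ?moment)
    and "0 < l \<Longrightarrow> measure (PiM {1..n} (\<lambda>_. mu)) {x\<in>space (PiM {1..n} (\<lambda>_. mu)).
        R x \<le> c * (real n powr (-1/2) + 2 * sqrt (1 / n * l) + 1 / n * l)} \<ge> 1 - exp (- l)" (is "_ \<Longrightarrow> ?tail")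
proof -
  interpret mu: prob_space mu by fact
  interpret pair: pair_prob_space mu mu ..
  have ne: "D \<noteq> {}"
    using D(2) by auto
  have id_mu: "(\<lambda>x. x) \<in> mu \<rightarrow>\<^sub>M borel"
    by (simp add: measurable_cong_sets[OF sets_mu refl])
  have sep [measurable]: "(\<lambda>(x, y). sep_dist D x y) \<in> borel_measurable (mu \<Otimes>\<^sub>M mu)"
    unfolding case_prod_beta'
    by (intro borel_measurable_sep_dist measurable_compose[OF measurable_fst id_mu]
        measurable_compose[OF measurable_snd id_mu] D)
  have [measurable]: "sep_dist D x \<in> borel_measurable mu" if "x \<in> space mu" for x
    using measurable_compose[OF measurable_Pair1'[OF that] sep] by simp
  have "{x\<in>space mu. x \<in> closure D} \<in> sets mu"
    using sets_mu sets_eq_imp_space_eq[OF sets_mu] by simp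
  with D(2) have "AE p in mu \<Otimes>\<^sub>M mu. fst p \<in> closure D"
    by (rule mu.AE_pair_fst)
  then have eq: "AE p in mu \<Otimes>\<^sub>M mu. (case p of (x, y) \<Rightarrow> sep_dist D x y) = (case p of (x, y) \<Rightarrow> dist x y)"
    by eventually_elim (auto simp: sep_dist_eq_dist)
  \<comment> \<open>Fubini is applied to the measurable substitute, which agrees almost everywhere
    with the distance in the hypothesis.\<close>
  have "(\<integral>\<^sup>+x. \<integral>\<^sup>+y. exp (sep_dist D x y / c) \<partial>mu \<partial>mu) =
      (\<integral>\<^sup>+p. exp ((case p of (x, y) \<Rightarrow> sep_dist D x y) / c) \<partial>(mu \<Otimes>\<^sub>M mu))"
    by (subst mu.nn_integral_fst[symmetric]) auto
  also have "\<dots> = (\<integral>\<^sup>+p. exp (\<bar>case p of (x, y) \<Rightarrow> dist x y\<bar> / c) \<partial>(mu \<Otimes>\<^sub>M mu))"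
    by (intro nn_integral_cong_AE eventually_mono[OF eq]) auto
  finally have exp_sep: "(\<integral>\<^sup>+x. \<integral>\<^sup>+y. exp (sep_dist D x y / c) \<partial>mu \<partial>mu) \<le> 2"
    using c(2) by simp

  \<comment> \<open>The added term exploits the constant in \<open>v^2 + 2 <= 2 * exp v\<close> at
    \<open>v = sep_dist D x y / c\<close>; without it the second moment would only be bounded by
    \<open>4 * c^2\<close>.\<close>
  have "(\<integral>\<^sup>+x. \<integral>\<^sup>+y. (sep_dist D x y)\<^sup>2 \<partial>mu \<partial>mu) + ennreal (2 * c\<^sup>2) =
      (\<integral>\<^sup>+x. \<integral>\<^sup>+y. ennreal ((sep_dist D x y)\<^sup>2) + ennreal (2 * c\<^sup>2) \<partial>mu \<partial>mu)"
  proof -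
    have "(\<integral>\<^sup>+x. \<integral>\<^sup>+y. ennreal ((sep_dist D x y)\<^sup>2) + ennreal (2 * c\<^sup>2) \<partial>mu \<partial>mu) =
        (\<integral>\<^sup>+x. (\<integral>\<^sup>+y. ennreal ((sep_dist D x y)\<^sup>2) \<partial>mu) + ennreal (2 * c\<^sup>2) \<partial>mu)"
      by (intro nn_integral_cong) (simp add: nn_integral_add mu.emeasure_space_1)
    then show ?thesis
      by (simp add: nn_integral_add mu.emeasure_space_1)
  qed
  also have "\<dots> \<le> (\<integral>\<^sup>+x. \<integral>\<^sup>+y. ennreal (2 * c\<^sup>2) * ennreal (exp (sep_dist D x y / c)) \<partial>mu \<partial>mu)"
  proof (intro nn_integral_mono)
    fix x y
    define v where "v = sep_dist D x y / c"
    have "0 \<le> v" "sep_dist D x y = c * v"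
      using c sep_dist_nonneg[OF ne] by (auto simp: v_def)
    have "2 * c\<^sup>2 * (1 + v + v\<^sup>2 / 2) \<le> 2 * c\<^sup>2 * exp v"
      using \<open>0 \<le> v\<close> by (intro mult_left_mono exp_lower_Taylor_quadratic) auto
    moreover have "0 \<le> c\<^sup>2 * v"
      using \<open>0 \<le> v\<close> by simp
    ultimately have "(c * v)\<^sup>2 + 2 * c\<^sup>2 \<le> 2 * c\<^sup>2 * exp v"
      by (simp add: algebra_simps power_mult_distrib)
    from ennreal_leI[OF this]
    show "ennreal ((sep_dist D x y)\<^sup>2) + ennreal (2 * c\<^sup>2) \<le>
        ennreal (2 * c\<^sup>2) * ennreal (exp (sep_dist D x y / c))"
      unfolding \<open>sep_dist D x y = c * v\<close> using c by (simp add: ennreal_mult)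
  qed
  also have "\<dots> = ennreal (2 * c\<^sup>2) * (\<integral>\<^sup>+x. \<integral>\<^sup>+y. exp (sep_dist D x y / c) \<partial>mu \<partial>mu)"
  proof -
    have "(\<integral>\<^sup>+x. \<integral>\<^sup>+y. ennreal (2 * c\<^sup>2) * ennreal (exp (sep_dist D x y / c)) \<partial>mu \<partial>mu) =
        (\<integral>\<^sup>+x. ennreal (2 * c\<^sup>2) * (\<integral>\<^sup>+y. exp (sep_dist D x y / c) \<partial>mu) \<partial>mu)"
      by (intro nn_integral_cong nn_integral_cmult) measurable
    then show ?thesis
      by (simp add: nn_integral_cmult)
  qed
  also have "\<dots> \<le> ennreal (2 * c\<^sup>2) * 2"
    by (intro mult_left_mono exp_sep) simp
  also have "\<dots> = ennreal (2 * c\<^sup>2) + ennreal (2 * c\<^sup>2)"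
    by (simp only: mult_2_right)
  finally have "ennreal (2 * c\<^sup>2) + (\<integral>\<^sup>+x. \<integral>\<^sup>+y. (sep_dist D x y)\<^sup>2 \<partial>mu \<partial>mu) \<le>
      ennreal (2 * c\<^sup>2) + ennreal (2 * c\<^sup>2)"
    by (simp only: ac_simps)
  then have V: "(\<integral>\<^sup>+x. \<integral>\<^sup>+y. (sep_dist D x y)\<^sup>2 \<partial>mu \<partial>mu) \<le> ennreal (2 * c\<^sup>2)"
    by (simp only: ennreal_add_left_cancel_le) simp
  interpret sampled_barycenter mu D n m B "2 * c\<^sup>2"
    using mu sets_mu D n m B V by unfold_locales auto
  show moment: ?moment
    using second_moment_bound[OF R R_eq] by simp

  assume l: "0 < l"
  define P where "P = PiM {1..n} (\<lambda>_. mu)"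
  have R' [measurable]: "R \<in> borel_measurable P"
    using R by (simp add: P_def)
  interpret P: prob_space P
    unfolding P_def by (intro prob_space_PiM mu)
  have "integrable P R \<and> P.prob {x\<in>space P. R x \<le> (\<integral>x. R x \<partial>P) + c * (2 * sqrt (l / n) + l / n)} \<ge> 1 - exp (- l)"
    unfolding P_def
  proof (rule subexponential_concentration[OF mu])
    show "\<bar>R x - R (x(i := y))\<bar> \<le> 1 / real n * sep_dist D (x i) y" if "i \<in> {1..n}" for i x y
    proof -
      have "(\<Sum>k\<in>{1..n}. sep_dist D (x k) ((x(i := y)) k)) = (\<Sum>k\<in>{i}. sep_dist D (x k) ((x(i := y)) k))"
        using that ne by (intro sum.mono_neutral_right) auto
      then show ?thesis
        using R_lip[of x "x(i := y)"] by simp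
    qed
  qed (use n c(1) sep exp_sep R l sep_dist_nonneg[OF ne] in auto)
  then have int: "integrable P R"
    and conc: "P.prob {x\<in>space P. R x \<le> (\<integral>x. R x \<partial>P) + c * (2 * sqrt (l / n) + l / n)} \<ge> 1 - exp (- l)"
    by auto
  \<comment> \<open>The root of the second-moment bound. With it
    \<open>R <= R^2 / (2 * s) + s / 2\<close> bounds the mean by \<open>s\<close>, a Cauchy-Schwarz
    estimate without roots of extended integrals.\<close>
  define s where "s = c * real n powr (-1/2)"
  have s: "0 < s" "s\<^sup>2 = c\<^sup>2 / n"
    using c n by (auto simp: s_def power_divide powr_minus_divide powr_half_sqrt)
  have "ennreal (\<integral>x. R x \<partial>P) \<le> (\<integral>\<^sup>+x. R x \<partial>P)"
    using int by (rule ennreal_integral_le)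
  also have "\<dots> \<le> (\<integral>\<^sup>+x. ennreal (1 / (2 * s)) * ennreal ((R x)\<^sup>2) + ennreal (s / 2) \<partial>P)"
  proof (intro nn_integral_mono)
    fix x
    have "R x \<le> 1 / (2 * s) * (R x)\<^sup>2 + s / 2"
      using sum_squares_bound[of "R x" s] s(1) by (simp add: field_simps power2_eq_square)
    from ennreal_leI[OF this]
    show "ennreal (R x) \<le> ennreal (1 / (2 * s)) * ennreal ((R x)\<^sup>2) + ennreal (s / 2)"
      using s(1) by (subst ennreal_mult[symmetric], simp, simp, subst ennreal_plus[symmetric]) auto
  qed
  also have "\<dots> = ennreal (1 / (2 * s)) * (\<integral>\<^sup>+x. (R x)\<^sup>2 \<partial>P) + ennreal (s / 2)"
    by (simp add: nn_integral_add nn_integral_cmult P.emeasure_space_1)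
  also have "\<dots> \<le> ennreal (1 / (2 * s)) * ennreal (s\<^sup>2) + ennreal (s / 2)"
    using moment by (intro add_right_mono mult_left_mono) (auto simp: P_def s)
  also have "\<dots> = ennreal (1 / (2 * s) * s\<^sup>2 + s / 2)"
    using s(1) by (subst ennreal_mult[symmetric], simp, simp, subst ennreal_plus[symmetric]) auto
  also have "1 / (2 * s) * s\<^sup>2 + s / 2 = s"
    using s(1) by (simp add: power2_eq_square)
  finally have mean: "(\<integral>x. R x \<partial>P) \<le> s"
    using s(1) by simp
  have "P.prob {x\<in>space P. R x \<le> (\<integral>x. R x \<partial>P) + c * (2 * sqrt (l / n) + l / n)} \<le>
      P.prob {x\<in>space P. R x \<le> c * (real n powr (-1/2) + 2 * sqrt (1 / n * l) + 1 / n * l)}"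
    using mean by (intro P.finite_measure_mono) (auto simp: s_def algebra_simps)
  with conc show ?tail
    unfolding P_def by linarith
qed

section \<open>Transfer to the norm and to the given sample\<close>

theorem corollary17:
  fixes mu :: "'a::hadamard_space measure"
    and M :: "'w measure"
    and X :: "nat \<Rightarrow> 'w \<Rightarrow> 'a"
    and n :: nat
    and phi_star :: 'a
    and phi_hat :: "'w \<Rightarrow> 'a"
  assumes "prob_space mu" and "sets mu = sets borel"
    and "separably_supported mu"
    and "dist_psi1_norm mu < \<infinity>"
    and "prob_space M"
    and "n \<ge> 1"
    and "prob_space.indep_vars M (\<lambda>_. borel) X {1..n}"
    and "\<And>i. i \<in> {1..n} \<Longrightarrow> distr M borel (X i) = mu"
    and "is_barycenter mu phi_star"
    and "\<And>w. w \<in> space M \<Longrightarrow> is_empirical_barycenter n (\<lambda>i. X i w) (phi_hat w)"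
  shows "(\<lambda>w. dist phi_star (phi_hat w)) \<in> borel_measurable (completion M)
    \<and> (\<forall>\<delta>>0. measure (completion M)
          {w \<in> space M. dist phi_star (phi_hat w) \<le>
             16 * enn2real (dist_psi1_norm mu) *
               (real n powr (-1/2) + 2 * sqrt (1 / real n * ln (1 / \<delta>))
                  + 1 / real n * ln (1 / \<delta>))}
        \<ge> 1 - \<delta>)
    \<and> (\<integral>\<^sup>+ w. ennreal ((dist phi_star (phi_hat w))\<^sup>2) \<partial>completion M)
        \<le> ennreal (2 ^ 8 * (enn2real (dist_psi1_norm mu))\<^sup>2 / real n)"
proof -
  interpret mu: prob_space mu by fact
  interpret M: prob_space M by fact
  obtain D where D: "countable D" "AE x in mu. x \<in> closure D"
    using \<open>separably_supported mu\<close> by (auto simp: separably_supported_def)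
  have ne: "D \<noteq> {}"
    using D(2) by auto
  obtain B :: "(nat \<Rightarrow> 'a) \<Rightarrow> 'a" where B: "\<And>x. is_empirical_barycenter n x (B x)"
    using empirical_barycenter_exists[OF \<open>n \<ge> 1\<close>] by metis
  define P where "P = PiM {1..n} (\<lambda>_. mu)"
  interpret P: prob_space P
    unfolding P_def by (intro prob_space_PiM mu.prob_space_axioms)
  have lip: "\<bar>dist phi_star (B x) - dist phi_star (B y)\<bar> \<le> 1 / real n * (\<Sum>i\<in>{1..n}. dist (x i) (y i))" for x y
  proof -
    have "\<bar>dist phi_star (B x) - dist phi_star (B y)\<bar> \<le> dist (B x) (B y)"
      by metric
    then show ?thesis
      using empirical_barycenter_lipschitz[OF \<open>n \<ge> 1\<close> B B] by (rule order_trans)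
  qed
  obtain R where R: "R \<in> borel_measurable (PiM {1..n} (\<lambda>_. mu))"
    and R_eq: "\<And>x. (\<And>i. i \<in> {1..n} \<Longrightarrow> x i \<in> closure D) \<Longrightarrow> R x = dist phi_star (B x)"
    and R_lip: "\<And>x y. \<bar>R x - R y\<bar> \<le> 1 / real n * (\<Sum>i\<in>{1..n}. sep_dist D (x i) (y i))"
    by (rule lipschitz_measurable_version[OF \<open>sets mu = sets borel\<close> finite_atLeastAtMost D(1) ne _ lip])
      (simp, rule that, assumption, blast, blast)
  have [measurable]: "R \<in> borel_measurable P"
    using R by (simp add: P_def)
  note deviation = barycenter_deviation[OF \<open>prob_space mu\<close> \<open>sets mu = sets borel\<close> D \<open>n \<ge> 1\<close>
      \<open>is_barycenter mu phi_star\<close> B _ _ R R_eq R_lip, folded P_def]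
  define kappa where "kappa = enn2real (dist_psi1_norm mu)"
  have norm: "dist_psi1_norm mu = ennreal kappa" "0 \<le> kappa"
    using \<open>dist_psi1_norm mu < \<infinity>\<close> by (auto simp: kappa_def)
  have admissible: "\<exists>c>0. c < b \<and> (\<integral>\<^sup>+p. exp (\<bar>case p of (x, y) \<Rightarrow> dist x y\<bar> / c) \<partial>(mu \<Otimes>\<^sub>M mu)) \<le> 2"
    if "kappa < b" for b
  proof -
    have "dist_psi1_norm mu < ennreal b"
      using that norm by (simp add: ennreal_less_iff)
    then show ?thesis
      unfolding dist_psi1_norm_def psi1_norm_def by (auto simp: Inf_less_iff ennreal_less_iff)
  qed

  have bounds: "(\<integral>\<^sup>+x. (R x)\<^sup>2 \<partial>P) \<le> ennreal (2 ^ 8 * kappa\<^sup>2 / n) \<and>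
     (\<forall>l>0. P.prob {x\<in>space P. R x \<le> 16 * kappa * (real n powr (-1/2) + 2 * sqrt (1 / n * l) + 1 / n * l)}
        \<ge> 1 - exp (- l))"
  proof (cases "kappa = 0")
    case False
    \<comment> \<open>The factor 2 avoids the question whether the infimum is attained.\<close>
    then obtain c where c: "0 < c" "c < 2 * kappa"
      "(\<integral>\<^sup>+p. exp (\<bar>case p of (x, y) \<Rightarrow> dist x y\<bar> / c) \<partial>(mu \<Otimes>\<^sub>M mu)) \<le> 2"
      using admissible[of "2 * kappa"] norm by auto
    have "c\<^sup>2 \<le> (2 * kappa)\<^sup>2"
      using c by (intro power_mono) auto
    also have "\<dots> \<le> 2 ^ 8 * kappa\<^sup>2"
      by (simp add: power_mult_distrib)
    finally have "ennreal (c\<^sup>2 / n) \<le> ennreal (2 ^ 8 * kappa\<^sup>2 / n)"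
      by (intro ennreal_leI divide_right_mono) auto
    moreover have "1 - exp (- l) \<le>
      P.prob {x\<in>space P. R x \<le> 16 * kappa * (real n powr (-1/2) + 2 * sqrt (1 / n * l) + 1 / n * l)}"
      if l: "0 < l" for l
    proof (rule order_trans[OF deviation(2)[OF c(1,3) _ l]])
      define K where "K = real n powr (-1/2) + 2 * sqrt (1 / n * l) + 1 / n * l"
      have "0 \<le> K"
        using l by (simp add: K_def)
      then have "c * K \<le> 16 * kappa * K"
        using c norm(2) by (intro mult_right_mono) auto
      then show "P.prob {x\<in>space P. R x \<le> c * (real n powr (-1/2) + 2 * sqrt (1 / n * l) + 1 / n * l)} \<le>
        P.prob {x\<in>space P. R x \<le> 16 * kappa * (real n powr (-1/2) + 2 * sqrt (1 / n * l) + 1 / n * l)}"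
        unfolding K_def[symmetric] by (intro P.finite_measure_mono) auto
    qed auto
    ultimately show ?thesis
      using deviation(1)[OF c(1,3)] by (auto intro: order_trans)
  next
    case True
    \<comment> \<open>A zero norm leaves no \<open>c\<close> below its double, but arbitrarily small
      \<open>c\<close> are admissible, so \<open>R\<close> vanishes almost everywhere.\<close>
    have small: "(\<integral>\<^sup>+x. (R x)\<^sup>2 \<partial>P) \<le> 0 + ennreal e" if "0 < e" for e
    proof -
      \<comment> \<open>With \<open>c < 1\<close>, the bound \<open>c < e\<close> passes to
        \<open>c^2\<close>.\<close>
      obtain c where c: "0 < c" "c < min 1 e"
        "(\<integral>\<^sup>+p. exp (\<bar>case p of (x, y) \<Rightarrow> dist x y\<bar> / c) \<partial>(mu \<Otimes>\<^sub>M mu)) \<le> 2"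
        using admissible[of "min 1 e"] True \<open>0 < e\<close> by auto
      have "c\<^sup>2 / n \<le> c\<^sup>2 / 1"
        using \<open>n \<ge> 1\<close> by (intro divide_left_mono) auto
      also have "c\<^sup>2 / 1 \<le> e"
        using c mult_mono[of c 1 c e] by (simp add: power2_eq_square)
      finally have "ennreal (c\<^sup>2 / n) \<le> 0 + ennreal e"
        by (simp add: ennreal_leI)
      moreover have "(\<integral>\<^sup>+x. (R x)\<^sup>2 \<partial>P) \<le> ennreal (c\<^sup>2 / n)"
        by (rule deviation(1)[OF c(1,3)]) auto
      ultimately show ?thesis
        by (rule order_trans[rotated])
    qed
    have "(\<integral>\<^sup>+x. (R x)\<^sup>2 \<partial>P) \<le> 0"
      by (rule ennreal_le_epsilon) (rule small)
    then have zero: "(\<integral>\<^sup>+x. (R x)\<^sup>2 \<partial>P) = 0"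
      by simp
    then have "AE x in P. R x = 0"
      by (subst (asm) nn_integral_0_iff_AE) auto
    then have "P.prob {x\<in>space P. R x \<le> 0} = 1"
      by (subst P.prob_Collect_eq_1) (auto elim: eventually_mono)
    then show ?thesis
      using True zero by simp
  qed

  have X [measurable]: "X i \<in> M \<rightarrow>\<^sub>M borel" if "i \<in> {1..n}" for i
    using \<open>M.indep_vars _ X _\<close> that by (simp add: M.indep_vars_def)
  define Y where "Y w = (\<lambda>i\<in>{1..n}. X i w)" for w
  have sets_P: "sets P = sets (PiM {1..n} (\<lambda>_. borel))"
    unfolding P_def using \<open>sets mu = sets borel\<close> by (intro sets_PiM_cong) auto
  have Y [measurable]: "Y \<in> M \<rightarrow>\<^sub>M P"
    unfolding measurable_cong_sets[OF refl sets_P] Y_def by (intro measurable_restrict X)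
  have law: "distr M P Y = P"
  proof -
    have "distr M P Y = distr M (PiM {1..n} (\<lambda>_. borel)) Y"
      using sets_P by (intro distr_cong) auto
    also have "\<dots> = PiM {1..n} (\<lambda>i. distr M borel (X i))"
      unfolding Y_def using \<open>n \<ge> 1\<close> X \<open>M.indep_vars _ X _\<close>
      by (subst M.indep_vars_iff_distr_eq_PiM'[symmetric]) auto
    also have "\<dots> = P"
      unfolding P_def using assms(8) by (intro PiM_cong) auto
    finally show ?thesis .
  qed
  have "AE w in M. X i w \<in> closure D" if i: "i \<in> {1..n}" for i
  proof (rule AE_distrD[OF X[OF i]])
    show "AE x in distr M borel (X i). x \<in> closure D"
      unfolding assms(8)[OF i] by (rule D(2))
  qed
  then have "AE w in M. \<forall>i\<in>{1..n}. X i w \<in> closure D"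
    by (intro AE_finite_allI) auto
  then have eq: "AE w in M. dist phi_star (phi_hat w) = R (Y w)"
    using AE_space
  proof eventually_elim
    fix w assume w: "\<forall>i\<in>{1..n}. X i w \<in> closure D" "w \<in> space M"
    have "is_empirical_barycenter n (Y w) (phi_hat w)"
      using assms(10)[OF w(2)] is_empirical_barycenter_cong[of n "Y w" "\<lambda>i. X i w"]
      by (simp add: Y_def)
    then have "phi_hat w = B (Y w)"
      using empirical_barycenter_unique[OF \<open>n \<ge> 1\<close>] B by blast
    moreover have "R (Y w) = dist phi_star (B (Y w))"
      using w(1) by (intro R_eq) (auto simp: Y_def)
    ultimately show "dist phi_star (phi_hat w) = R (Y w)"
      by simp
  qed
  have RY: "(\<lambda>w. R (Y w)) \<in> borel_measurable M"
    by measurable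
  have meas [measurable]: "(\<lambda>w. dist phi_star (phi_hat w)) \<in> borel_measurable (completion M)"
    by (rule borel_measurable_completion_AE[OF RY eq])
  \<comment> \<open>Almost-everywhere equality and the law of \<open>Y\<close> carry events of the
    completed space to the product measure.\<close>
  have prob: "measure (completion M) {w\<in>space M. dist phi_star (phi_hat w) \<le> b} = P.prob {x\<in>space P. R x \<le> b}"
    for b
  proof -
    have "measure (completion M) {w\<in>space M. dist phi_star (phi_hat w) \<le> b} =
        measure (completion M) {w\<in>space M. R (Y w) \<le> b}"
    proof (rule measure_eq_AE)
      show "AE w in completion M. w \<in> {w\<in>space M. dist phi_star (phi_hat w) \<le> b} \<longleftrightarrow> w \<in> {w\<in>space M. R (Y w) \<le> b}"
        using AE_completion[OF eq] by eventually_elim auto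
      have "{w\<in>space (completion M). dist phi_star (phi_hat w) \<le> b} \<in> sets (completion M)"
        by measurable
      then show "{w\<in>space M. dist phi_star (phi_hat w) \<le> b} \<in> sets (completion M)"
        by simp
      show "{w\<in>space M. R (Y w) \<le> b} \<in> sets (completion M)"
        by (intro sets_completionI_sets) measurable
    qed
    also have "\<dots> = measure M {w\<in>space M. R (Y w) \<le> b}"
      by (intro measure_completion) measurable
    also have "\<dots> = measure (distr M P Y) {x\<in>space P. R x \<le> b}"
      by (subst measure_distr) (auto intro!: arg_cong[of _ _ "measure M"] dest: measurable_space[OF Y])
    finally show ?thesis
      by (simp add: law)
  qed
  have "(\<integral>\<^sup>+w. (dist phi_star (phi_hat w))\<^sup>2 \<partial>completion M) = (\<integral>\<^sup>+w. (R (Y w))\<^sup>2 \<partial>M)"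
    unfolding nn_integral_completion by (intro nn_integral_cong_AE eventually_mono[OF eq]) simp
  also have "\<dots> = (\<integral>\<^sup>+x. (R x)\<^sup>2 \<partial>distr M P Y)"
    by (subst nn_integral_distr) auto
  also have "\<dots> \<le> ennreal (2 ^ 8 * kappa\<^sup>2 / n)"
    using bounds by (simp add: law)
  finally have moment: "(\<integral>\<^sup>+w. (dist phi_star (phi_hat w))\<^sup>2 \<partial>completion M) \<le> ennreal (2 ^ 8 * kappa\<^sup>2 / n)" .
  have tail: "1 - d \<le> measure (completion M) {w\<in>space M. dist phi_star (phi_hat w) \<le>
      16 * kappa * (real n powr (-1/2) + 2 * sqrt (1 / real n * ln (1 / d)) + 1 / real n * ln (1 / d))}"
    if d: "0 < d" for d
  proof (cases "d < 1")
    case True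
    with d have l: "0 < ln (1 / d)" and d_eq: "exp (- ln (1 / d)) = d"
      by (auto simp: ln_div)
    show ?thesis
      unfolding prob using bounds[THEN conjunct2, rule_format, OF l] by (simp only: d_eq)
  next
    case False
    \<comment> \<open>The logarithm is not positive here and the claim is vacuous.\<close>
    then have "1 - d \<le> 0" by simp
    then show ?thesis
      using measure_nonneg order_trans by blast
  qed
  show ?thesis
    unfolding kappa_def[symmetric] by (intro conjI allI impI meas moment tail)
qed

end
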